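(* Consider a normalized Hamburger moment problem with orthonormal polynomials $P_n$, polynomials of the second kind $Q_n$ and recurrence coefficients $a_n\in\mathbb R$, $b_n>0$, and let $0<\alpha\le 1$. The following conditions are equivalent: (i) $(P_n^2(0)),(Q_n^2(0))\in\ell^{\alpha}$; (ii) $(P_n^2(z)),(Q_n^2(z))\in\ell^{\alpha}$ for all $z\in\mathbb C$. If the conditions are satisfied, then the moment problem is indeterminate, and the two series $\sum_{n}|P_n(z)|^{2\alpha}$ and $\sum_n|Q_n(z)|^{2\alpha}$ converge uniformly on compact subsets of $\mathbb C$. Furthermore, $(1/b_n)\in\ell^{\alpha}$ and $$P(z)\le C\exp(K|z|^\alpha),\quad z\in\mathbb C,$$ where $$C=\Big(\sum_{n=0}^\infty(P_n^2(0)+Q_n^2(0))\Big)^{1/2},\qquad K=\frac1\alpha\sum_{n=0}^\infty\big(|P_n(0)|^{2\alpha}+|Q_n(0)|^{2\alpha}\big).$$ In particular the moment problem has order $\rho\le\alpha$, and if the order is $\alpha$, then its type satisfies $\tau\le K$.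
   Context: A normalized Hamburger moment problem is given by a sequence $s_n=\int_{-\infty}^\infty x^n\,d\mu(x)$, $n\ge0$, where $\mu$ is a probability measure on $\mathbb R$ with infinite support and moments of every order. It is indeterminate if more than one measure $\mu$ has these moments. Let $P_n$ be the orthonormal polynomials (positive leading coefficients) and $Q_n$ the polynomials of the second kind. Both are solutions of $$z r_n(z)=b_nr_{n+1}(z)+a_nr_n(z)+b_{n-1}r_{n-1}(z),\quad n\ge0,$$ with $a_n\in\mathbb R$, $b_n>0$ for $n\ge 0$, $b_{-1}=1$, and initial conditions $P_0=1$, $P_{-1}=0$, $Q_0=0$, $Q_{-1}=-1$. Put $P(z)=(\sum_{n\ge0}|P_n(z)|^2)^{1/2}$ and $Q(z)=(\sum_{n\ge0}|Q_n(z)|^2)^{1/2}$; in the indeterminate case these are finite and continuous on $\mathbb C$. For $\alpha>0$, $\ell^\alpha=\{(x_n)\mid \sum_{n}|x_n|^\alpha<\infty\}$ (complex sequences). For an unbounded continuous $f:\mathbb C\to\mathbb C$ let $M_f(r)=\max_{|z|\le r}|f(z)|$. The order of $f$ is $\rho_f=\inf\{a>0\mid \log M_f(r)\le r^a\text{ for all sufficiently large }r\}$, and if $0<\rho_f<\infty$ the type is $\tau_f=\inf\{c>0\mid \log M_f(r)\le c\,r^{\rho_f}\text{ for all sufficiently large }r\}$. The order $\rho$ and type $\tau$ of an indeterminate moment problem are the order and type of $P$ (it is known that $Q$ and the four entire Nevanlinna functions $A,B,C,D$ have the same order and type as $P$). *)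

theory Defs
  imports "HOL-Probability.Probability" "HOL-Computational_Algebra.Polynomial"
begin

definition measure_support :: "real measure \<Rightarrow> real set" where
  "measure_support \<mu> = {x. \<forall>U. open U \<longrightarrow> x \<in> U \<longrightarrow> emeasure \<mu> U \<noteq> 0}"

definition represents_moments :: "real measure \<Rightarrow> (nat \<Rightarrow> real) \<Rightarrow> bool" where
  "represents_moments \<mu> s \<longleftrightarrow> sets \<mu> = sets borel \<and>
     (\<forall>n. integrable \<mu> (\<lambda>x. x ^ n) \<and> (\<integral>x. x ^ n \<partial>\<mu>) = s n)"

definition normalized_hamburger :: "real measure \<Rightarrow> (nat \<Rightarrow> real) \<Rightarrow> bool" where
  "normalized_hamburger \<mu> s \<longleftrightarrow>
     prob_space \<mu> \<and> infinite (measure_support \<mu>) \<and> represents_moments \<mu> s"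

definition indeterminate :: "(nat \<Rightarrow> real) \<Rightarrow> bool" where
  "indeterminate s \<longleftrightarrow>
     (\<exists>\<mu> \<nu>. represents_moments \<mu> s \<and> represents_moments \<nu> s \<and> \<mu> \<noteq> \<nu>)"

definition orthonormal_polys :: "real measure \<Rightarrow> (nat \<Rightarrow> real poly) \<Rightarrow> bool" where
  "orthonormal_polys \<mu> P \<longleftrightarrow>
     (\<forall>n. degree (P n) = n \<and> lead_coeff (P n) > 0) \<and>
     (\<forall>m n. (\<integral>x. poly (P m) x * poly (P n) x \<partial>\<mu>) = (if m = n then 1 else 0))"

text \<open>
  The recurrence \<open>x r\<^sub>n = b\<^sub>n r\<^sub>n\<^sub>+\<^sub>1 + a\<^sub>n r\<^sub>n + b\<^sub>n\<^sub>-\<^sub>1 r\<^sub>n\<^sub>-\<^sub>1\<close> for all \<open>n \<ge> 0\<close>.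
  The argument \<open>c\<close> is the constant \<open>r\<^sub>-\<^sub>1\<close>, and \<open>b\<^sub>-\<^sub>1 = 1\<close>.
\<close>

definition solves_recurrence ::
    "(nat \<Rightarrow> real) \<Rightarrow> (nat \<Rightarrow> real) \<Rightarrow> real \<Rightarrow> (nat \<Rightarrow> real poly) \<Rightarrow> bool" where
  "solves_recurrence a b c r \<longleftrightarrow>
     (\<forall>n. [:0, 1:] * r n = smult (b n) (r (Suc n)) + smult (a n) (r n) +
            (case n of 0 \<Rightarrow> [:c:] | Suc m \<Rightarrow> smult (b m) (r m)))"

text \<open>
  For the orthonormal polynomials \<open>P\<close> of a measure of infinite support, this
  determines \<open>a\<close> and \<open>b\<close> uniquely.
\<close>

definition recurrence_coeffs ::
    "(nat \<Rightarrow> real) \<Rightarrow> (nat \<Rightarrow> real) \<Rightarrow> (nat \<Rightarrow> real poly) \<Rightarrow> bool" where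
  "recurrence_coeffs a b P \<longleftrightarrow> (\<forall>n. b n > 0) \<and> P 0 = 1 \<and> solves_recurrence a b 0 P"

definition second_kind_polys ::
    "(nat \<Rightarrow> real) \<Rightarrow> (nat \<Rightarrow> real) \<Rightarrow> (nat \<Rightarrow> real poly) \<Rightarrow> bool" where
  "second_kind_polys a b Q \<longleftrightarrow> Q 0 = 0 \<and> solves_recurrence a b (-1) Q"

definition cpoly :: "real poly \<Rightarrow> complex \<Rightarrow> complex" where
  "cpoly p z = poly (map_poly complex_of_real p) z"

definition ell :: "real \<Rightarrow> (nat \<Rightarrow> complex) set" where
  "ell \<alpha> = {x. summable (\<lambda>n. cmod (x n) powr \<alpha>)}"

definition l2_function :: "(nat \<Rightarrow> real poly) \<Rightarrow> complex \<Rightarrow> real" where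
  "l2_function r z = sqrt (\<Sum>n. (cmod (cpoly (r n) z))\<^sup>2)"

text \<open>
  For continuous \<open>f\<close> the supremum is a maximum. Order and type are extended reals,
  so that the infimum of the empty set is \<open>\<infinity>\<close>. They are meant for unbounded \<open>f\<close>, where
  \<open>max_modulus f r > 1\<close> for large \<open>r\<close>, and the type for \<open>0 < growth_order f < \<infinity>\<close>.
\<close>

definition max_modulus :: "(complex \<Rightarrow> 'a::real_normed_vector) \<Rightarrow> real \<Rightarrow> real" where
  "max_modulus f r = (SUP z\<in>cball 0 r. norm (f z))"

definition growth_order :: "(complex \<Rightarrow> 'a::real_normed_vector) \<Rightarrow> ereal" where
  "growth_order f =
     Inf {ereal a |a. a > 0 \<and> (\<forall>\<^sub>F r in at_top. ln (max_modulus f r) \<le> r powr a)}"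

definition growth_type :: "(complex \<Rightarrow> 'a::real_normed_vector) \<Rightarrow> ereal" where
  "growth_type f =
     Inf {ereal c |c. c > 0 \<and>
       (\<forall>\<^sub>F r in at_top. ln (max_modulus f r) \<le> c * r powr real_of_ereal (growth_order f))}"

end

theory Submission
  imports Defs "HOL-Computational_Algebra.Fundamental_Theorem_Algebra" "HOL-Real_Asymp.Real_Asymp"
begin

text \<open>
  Write \<open>u\<^sub>k = P\<^sub>k(0)\<close>, \<open>v\<^sub>k = Q\<^sub>k(0)\<close>, \<open>w\<^sub>k = u\<^sub>k\<^sup>2 + v\<^sub>k\<^sup>2\<close>. Expanding a solution at \<open>z\<close> in the two
  solutions at \<open>0\<close> gives coefficient vectors whose norm grows by at most the factor
  \<open>1 + |z| w\<^sub>k\<close> in step \<open>k\<close>. Hence \<open>|P\<^sub>n(z)|\<^sup>2 \<le> w\<^sub>n \<Prod>\<^sub>k (1 + |z| w\<^sub>k)\<^sup>2\<close>, likewise for \<open>Q\<^sub>n\<close>, and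
  \<open>1 + x \<le> exp (x\<^sup>\<alpha> / \<alpha>)\<close> turns the product into the exponential bound. The summability of
  \<open>(1 / b\<^sub>n)\<^sup>\<alpha>\<close> comes from the Wronskian identity \<open>1 / b\<^sub>n = u\<^sub>n v\<^sub>n\<^sub>+\<^sub>1 - u\<^sub>n\<^sub>+\<^sub>1 v\<^sub>n\<close>.

  For indeterminacy, Gauss quadratures with a node prescribed at a real point \<open>x\<close> converge weakly,
  along a subsequence, to a representing measure with an atom of mass at least
  \<open>1 / \<Sum> P\<^sub>n(x)\<^sup>2\<close> at \<open>x\<close>. This mass is bounded below for \<open>x\<close> in a bounded interval, so a unique
  representing measure would have infinitely many atoms of mass bounded below.
\<close>

section \<open>Real polynomials at complex points\<close>

lemma cpoly_0 [simp]: "cpoly 0 z = 0"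
  by (simp add: cpoly_def)

lemma cpoly_pCons [simp]: "cpoly (pCons c p) z = of_real c + z * cpoly p z"
  by (simp add: cpoly_def map_poly_pCons)

lemma cpoly_1 [simp]: "cpoly 1 z = 1"
  by (simp add: cpoly_def)

lemma cpoly_add [simp]: "cpoly (p + q) z = cpoly p z + cpoly q z"
  by (induction p q rule: poly_induct2) (simp_all add: algebra_simps)

lemma cpoly_smult [simp]: "cpoly (smult c p) z = of_real c * cpoly p z"
  by (induction p) (simp_all add: algebra_simps)

lemma cpoly_mult [simp]: "cpoly (p * q) z = cpoly p z * cpoly q z"
  by (induction p) (simp_all add: algebra_simps)

lemma cpoly_of_real [simp]: "cpoly p (of_real x) = of_real (poly p x)"
  by (induction p) simp_all

lemma cpoly_at_0: "cpoly p 0 = of_real (poly p 0)"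
  using cpoly_of_real[of p 0] by simp

lemma cpoly_root_exists:
  assumes "degree p \<noteq> 0"
  obtains z where "cpoly p z = 0"
proof -
  have "degree (map_poly complex_of_real p) = degree p"
    by (simp add: degree_map_poly)
  with assms have "\<nexists>c l. c \<noteq> 0 \<and> l = 0 \<and> map_poly complex_of_real p = pCons c l"
    by auto
  from fundamental_theorem_of_algebra_alt[OF this] that show thesis
    unfolding cpoly_def by blast
qed

text \<open>The remainder of \<open>p\<close> modulo the quadratic is a real polynomial
  \<open>c + d t\<close> that vanishes at the nonreal \<open>z\<close>; the imaginary part forces
  \<open>d = 0\<close>, and then \<open>c = 0\<close>.\<close>

lemma quadratic_factor_dvd:
  assumes z: "cpoly p z = 0" and "Im z \<noteq> 0"
  shows "[:(Re z)\<^sup>2 + (Im z)\<^sup>2, - 2 * Re z, 1:] dvd p"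
proof -
  define q where "q = [:(Re z)\<^sup>2 + (Im z)\<^sup>2, - 2 * Re z, 1:]"
  have q: "cpoly q z = 0"
    by (simp add: q_def complex_eq_iff power2_eq_square algebra_simps)
  have "degree q = 2" by (simp add: q_def)
  then have "degree (p mod q) \<le> 1"
    using degree_mod_less[of q p] by fastforce
  then obtain c d where cd: "p mod q = [:c, d:]"
    by (metis degree1_coeffs degree_0_id degree_pCons_0 le_Suc_eq le_zero_eq One_nat_def pCons_0_0)
  have "p = q * (p div q) + p mod q" by simp
  then have "cpoly p z = cpoly q z * cpoly (p div q) z + cpoly (p mod q) z"
    by (metis cpoly_add cpoly_mult)
  then have "of_real c + z * of_real d = 0"
    using z q cd by simp
  then have "c = 0" "d = 0"
    using assms(2) by (auto simp: complex_eq_iff)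
  then show ?thesis
    using cd by (simp add: q_def dvd_eq_mod_eq_0)
qed

text \<open>Excluded factors with \<open>y \<noteq> 0\<close> belong to nonreal conjugate pairs,
  those with \<open>y = 0\<close> to double real roots. Hence every root is real and simple, and the
  induction splits off one at a time.\<close>

lemma card_real_roots_eq_degree:
  fixes p :: "real poly"
  assumes "p \<noteq> 0" and "\<And>x y. \<not> [:x\<^sup>2 + y\<^sup>2, - 2 * x, 1:] dvd p"
  shows "card {x. poly p x = 0} = degree p"
  using assms
proof (induction "degree p" arbitrary: p)
  case 0
  then obtain c where "p = [:c:]"
    by (metis degree_eq_zeroE)
  with 0 show ?case by simp
next
  case (Suc n)
  obtain z where z: "cpoly p z = 0"
    using cpoly_root_exists Suc.hyps(2) by (metis nat.distinct(1))
  have "Im z = 0"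
    using quadratic_factor_dvd[OF z] Suc.prems(2) by blast
  then obtain x where "z = of_real x"
    by (metis complex_is_Real_iff Reals_cases)
  with z have "poly p x = 0" by simp
  then obtain q where q: "p = [:- x, 1:] * q"
    by (auto simp: poly_eq_0_iff_dvd)
  with Suc.prems have "q \<noteq> 0" by auto
  then have deg: "degree p = Suc (degree q)"
    unfolding q by (subst degree_mult_eq) auto
  have "poly q x \<noteq> 0"
  proof
    assume "poly q x = 0"
    then obtain g where "q = [:- x, 1:] * g"
      by (auto simp: poly_eq_0_iff_dvd)
    then have "p = ([:- x, 1:] * [:- x, 1:]) * g"
      unfolding q by (simp only: mult.assoc)
    also have "[:- x, 1:] * [:- x, 1:] = [:x\<^sup>2 + 0\<^sup>2, - 2 * x, 1:]"
      by (simp add: power2_eq_square)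
    finally have "p = [:x\<^sup>2 + 0\<^sup>2, - 2 * x, 1:] * g" .
    with Suc.prems(2) show False by (metis dvd_triv_left)
  qed
  moreover have "card {y. poly q y = 0} = degree q"
    using Suc deg \<open>q \<noteq> 0\<close> q by (metis dvd_mult nat.inject)
  moreover have "{y. poly p y = 0} = insert x {y. poly q y = 0}"
    by (auto simp: q)
  ultimately show ?case
    using deg poly_roots_finite[OF \<open>q \<noteq> 0\<close>] by simp
qed

lemma linear_mult_neq_0: "p \<noteq> 0 \<Longrightarrow> [:- x, 1:] * p \<noteq> 0" for x :: real
  unfolding mult_eq_0_iff by simp

section \<open>Gauss quadrature with a prescribed node\<close>

definition poly_moment :: "real measure \<Rightarrow> real poly \<Rightarrow> real" where
  "poly_moment \<mu> p = (\<integral>x. poly p x \<partial>\<mu>)"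

locale moment_functional =
  fixes \<mu> :: "real measure" and s :: "nat \<Rightarrow> real" and P :: "nat \<Rightarrow> real poly"
  assumes moments: "represents_moments \<mu> s" and orthonormal: "orthonormal_polys \<mu> P"
begin

abbreviation L :: "real poly \<Rightarrow> real" where "L \<equiv> poly_moment \<mu>"

lemma degree_P: "degree (P n) = n" and lead_coeff_P: "lead_coeff (P n) > 0"
  using orthonormal unfolding orthonormal_polys_def by blast+

lemma L_P_P: "L (P m * P n) = (if m = n then 1 else 0)"
proof -
  have "poly (P m * P n) = (\<lambda>x. poly (P m) x * poly (P n) x)" by auto
  then show ?thesis
    using orthonormal unfolding orthonormal_polys_def poly_moment_def by metis
qed

lemma integrable_poly: "integrable \<mu> (poly p)"
proof -
  have "integrable \<mu> (\<lambda>x. \<Sum>i\<le>degree p. coeff p i * x ^ i)"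
    using moments unfolding represents_moments_def
    by (intro Bochner_Integration.integrable_sum integrable_mult_right) auto
  then show ?thesis by (simp add: poly_altdef[abs_def])
qed

lemma L_add: "L (p + q) = L p + L q"
proof -
  have "poly (p + q) = (\<lambda>x. poly p x + poly q x)" by auto
  then show ?thesis by (simp add: poly_moment_def integrable_poly)
qed

lemma L_smult: "L (smult c p) = c * L p"
proof -
  have "poly (smult c p) = (\<lambda>x. c * poly p x)" by auto
  then show ?thesis by (simp add: poly_moment_def)
qed

lemma L_0: "L 0 = 0"
  using L_smult[of 0 0] by simp

lemma L_sum: "L (\<Sum>i\<in>A. f i) = (\<Sum>i\<in>A. L (f i))"
  by (induction A rule: infinite_finite_induct) (simp_all add: L_0 L_add)

lemma L_monom: "L (monom 1 k) = s k"
proof -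
  have "poly (monom (1::real) k) = (\<lambda>x. x ^ k)" 
    by (auto simp: poly_monom)
  then show ?thesis
    using moments by (simp add: poly_moment_def represents_moments_def)
qed

text \<open>Subtracting a multiple of \<open>P n\<close> removes the coefficient of degree
  \<open>n\<close>. The disjunct \<open>q = 0\<close> admits the zero polynomial at
  \<open>n = 0\<close>, since its degree counts as 0.\<close>

lemma P_expansion:
  assumes "q = 0 \<or> degree q < n"
  obtains c where "q = (\<Sum>k<n. smult (c k) (P k))"
proof -
  have "\<exists>c. q = (\<Sum>k<n. smult (c k) (P k))"
    using assms
  proof (induction n arbitrary: q)
    case (Suc n)
    define d where "d = coeff q n / lead_coeff (P n)"
    define g where "g = q - smult d (P n)"
    have "degree q \<le> n" using Suc.prems by auto
    then have "degree g \<le> n"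
      unfolding g_def by (intro degree_diff_le) (auto simp: degree_P)
    moreover have "coeff g n = 0"
      using lead_coeff_P[of n] by (simp add: g_def d_def degree_P)
    ultimately have "g = 0 \<or> degree g < n"
      by (metis leading_coeff_0_iff le_neq_implies_less)
    then obtain c where c: "g = (\<Sum>k<n. smult (c k) (P k))"
      using Suc.IH by blast
    have "q = (\<Sum>k<Suc n. smult ((c(n := d)) k) (P k))"
      using c by (simp add: g_def algebra_simps)
    then show ?case by blast
  qed auto
  with that show thesis by blast
qed

lemma L_P_expansion: "L (P k * (\<Sum>j<n. smult (c j) (P j))) = (if k < n then c k else 0)"
  by (simp add: sum_distrib_left L_sum L_smult L_P_P sum.delta if_distrib cong: if_cong)

text \<open>By orthonormality \<open>L (q * q)\<close> is the sum of the squared coefficients of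
  \<open>q\<close> in the basis \<open>P\<close>, and these do not all vanish.\<close>

lemma L_sq_pos:
  assumes "q \<noteq> 0"
  shows "0 < L (q * q)"
proof -
  obtain c where c: "q = (\<Sum>k<Suc (degree q). smult (c k) (P k))"
    using P_expansion[of q "Suc (degree q)"] by auto
  let ?n = "Suc (degree q)"
  have "L (q * q) = L ((\<Sum>k<?n. smult (c k) (P k)) * q)"
    using c by simp
  also have "\<dots> = (\<Sum>k<?n. c k * L (P k * q))"
    by (simp only: sum_distrib_right L_sum mult_smult_left L_smult)
  also have "\<dots> = (\<Sum>k<?n. c k * L (P k * (\<Sum>k<?n. smult (c k) (P k))))"
    using c by simp
  also have "\<dots> = (\<Sum>k<?n. c k * c k)"
    by (simp only: L_P_expansion) simp
  finally have eq: "L (q * q) = (\<Sum>k<?n. c k * c k)" .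
  have "\<exists>k<?n. c k \<noteq> 0"
  proof (rule ccontr)
    assume "\<not> ?thesis"
    then have "(\<Sum>k<?n. smult (c k) (P k)) = 0" by (intro sum.neutral) auto
    with c assms show False by simp
  qed
  then obtain i where i: "i < ?n" "c i \<noteq> 0" by blast
  show ?thesis
    unfolding eq
  proof (rule sum_pos2[of _ i])
    show "0 < c i * c i" using i(2) by (metis not_real_square_gt_zero)
  qed (use i(1) in auto)
qed

lemma L_sq_nonneg: "0 \<le> L (q * q)"
  using L_sq_pos[of q] L_0 by (cases "q = 0") auto

text \<open>The Christoffel-Darboux kernel as a polynomial in its second variable; under
  \<open>L\<close> it represents evaluation at \<open>x\<close> on polynomials of degree below
  \<open>n\<close>.\<close>

definition kernel :: "nat \<Rightarrow> real \<Rightarrow> real poly" where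
  "kernel n x = (\<Sum>k<n. smult (poly (P k) x) (P k))"

lemma poly_kernel: "poly (kernel n x) y = (\<Sum>k<n. poly (P k) x * poly (P k) y)"
  by (simp add: kernel_def poly_sum)

lemma L_kernel:
  assumes "q = 0 \<or> degree q < n"
  shows "L (kernel n x * q) = poly q x"
proof -
  obtain c where c: "q = (\<Sum>k<n. smult (c k) (P k))"
    using P_expansion[OF assms] .
  have "L (kernel n x * q) = (\<Sum>k<n. poly (P k) x * L (P k * q))"
    by (simp only: kernel_def sum_distrib_right L_sum mult_smult_left L_smult)
  also have "\<dots> = (\<Sum>k<n. poly (P k) x * c k)"
    unfolding c by (simp only: L_P_expansion) simp
  also have "\<dots> = poly q x"
    unfolding c by (simp add: poly_sum mult.commute)
  finally show ?thesis .
qed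

lemma kernel_pos:
  assumes "0 < n"
  shows "0 < poly (kernel n x) x"
proof -
  obtain c where "P 0 = [:c:]" using degree_P[of 0] by (rule degree_eq_zeroE)
  then have "poly (P 0) x \<noteq> 0" using lead_coeff_P[of 0] by auto
  then show ?thesis
    unfolding poly_kernel using assms
    by (intro sum_pos2[where i = 0]) (auto simp: zero_less_mult_iff)
qed

lemma degree_kernel:
  assumes "poly (P n) x \<noteq> 0"
  shows "degree (kernel (Suc n) x) = n"
proof (rule antisym)
  show "degree (kernel (Suc n) x) \<le> n"
    unfolding kernel_def by (intro degree_sum_le) (auto simp: degree_P)
  have "coeff (kernel (Suc n) x) n = poly (P n) x * coeff (P n) n"
    unfolding kernel_def by (simp add: coeff_sum degree_P coeff_eq_0)
  then show "n \<le> degree (kernel (Suc n) x)"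
    using assms lead_coeff_P[of n] by (intro le_degree) (simp add: degree_P)
qed

text \<open>If all later \<open>P n\<close> vanished at \<open>x\<close>, the kernel would become a
  fixed \<open>k\<close> representing evaluation at \<open>x\<close> in every degree. Testing it on
  \<open>(t - x)^2 k\<close> gives \<open>L (((t - x) k)^2) = 0\<close>, against positivity.\<close>

lemma frequently_P_nonzero:
  obtains n where "m \<le> n" "poly (P n) x \<noteq> 0"
proof (rule ccontr)
  assume "\<not> thesis"
  with that have zero: "poly (P n) x = 0" if "m \<le> n" for n
    using \<open>m \<le> n\<close> by blast
  define k where "k = kernel (Suc m) x"
  define q where "q = [:- x, 1:] * [:- x, 1:] * k"
  define n where "n = max (Suc m) (Suc (degree q))"
  have "k \<noteq> 0"
    using kernel_pos[of "Suc m" x] by (auto simp: k_def)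
  have "kernel n x = k"
    unfolding kernel_def k_def
    by (intro sum.mono_neutral_right) (auto simp: n_def zero)
  moreover have "q = 0 \<or> degree q < n"
    by (auto simp: n_def)
  ultimately have "L (k * q) = poly q x"
    using L_kernel by metis
  also have "\<dots> = 0" by (simp add: q_def)
  also have "k * q = ([:- x, 1:] * k) * ([:- x, 1:] * k)"
    by (simp only: q_def mult_ac)
  finally show False
    using L_sq_pos[OF linear_mult_neq_0[OF \<open>k \<noteq> 0\<close>], of x] by (simp only: less_irrefl)
qed

text \<open>The nodes are the zeros of \<open>W\<close>, a polynomial of degree \<open>n + 1\<close>
  that vanishes at \<open>x\<close> and is orthogonal to all degrees below \<open>n\<close>; this is
  what makes the rule exact up to degree \<open>2 * n\<close>. The weight at \<open>x\<close> is the
  Christoffel number.\<close>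

lemma gauss_quadrature:
  assumes "poly (P n) x \<noteq> 0"
  obtains S \<omega> where "finite S" "x \<in> S" "\<And>y. y \<in> S \<Longrightarrow> 0 < \<omega> y"
    "\<And>p. degree p \<le> 2 * n \<Longrightarrow> L p = (\<Sum>y\<in>S. \<omega> y * poly p y)"
    "\<omega> x = 1 / (\<Sum>k\<le>n. (poly (P k) x)\<^sup>2)"
proof -
  define k where "k = kernel (Suc n) x"
  define W where "W = [:- x, 1:] * k"
  have kx: "0 < poly k x" unfolding k_def by (rule kernel_pos) simp
  then have "k \<noteq> 0" by auto
  then have "W \<noteq> 0" unfolding W_def by (rule linear_mult_neq_0)
  have deg_k: "degree k = n" unfolding k_def by (rule degree_kernel) fact
  then have deg_W: "degree W = Suc n"
    unfolding W_def using \<open>k \<noteq> 0\<close> by (subst degree_mult_eq) auto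
  \<comment> \<open>Moving the factor \<open>t - x\<close> from \<open>W\<close> to \<open>q\<close>
    leaves the kernel against a polynomial of degree at most \<open>n\<close> that vanishes at
    \<open>x\<close>.\<close>
  have L_W: "L (W * q) = 0" if "q = 0 \<or> degree q < n" for q
  proof -
    have "L (W * q) = L (k * ([:- x, 1:] * q))"
      by (simp only: W_def mult_ac)
    also have "\<dots> = poly ([:- x, 1:] * q) x"
    proof (unfold k_def, rule L_kernel)
      show "[:- x, 1:] * q = 0 \<or> degree ([:- x, 1:] * q) < Suc n"
        using that degree_mult_le[of "[:- x, 1:]" q] by auto
    qed
    finally show ?thesis by simp
  qed
  \<comment> \<open>A factor \<open>(t - c)\<^sup>2 + d\<^sup>2\<close> with cofactor \<open>g\<close> would make \<open>L (W g)\<close> positive.\<close>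
  have no_quadratic: "\<not> [:c\<^sup>2 + d\<^sup>2, - 2 * c, 1:] dvd W" for c d
  proof
    assume "[:c\<^sup>2 + d\<^sup>2, - 2 * c, 1:] dvd W"
    then obtain g where g: "W = [:c\<^sup>2 + d\<^sup>2, - 2 * c, 1:] * g" by (elim dvdE)
    with \<open>W \<noteq> 0\<close> have "g \<noteq> 0" by auto
    then have "degree W = 2 + degree g"
      unfolding g by (subst degree_mult_eq) auto
    then have "L (W * g) = 0"
      using deg_W by (intro L_W) simp
    moreover have "W * g = ([:- c, 1:] * g) * ([:- c, 1:] * g) + smult (d\<^sup>2) (g * g)"
    proof -
      have "[:c\<^sup>2 + d\<^sup>2, - 2 * c, 1:] = [:- c, 1:] * [:- c, 1:] + [:d\<^sup>2:]"
        by (simp add: power2_eq_square)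
      moreover have "smult (d\<^sup>2) (g * g) = [:d\<^sup>2:] * (g * g)"
        by simp
      ultimately show ?thesis
        unfolding g by (simp only: algebra_simps)
    qed
    then have "L (W * g) = L (([:- c, 1:] * g) * ([:- c, 1:] * g)) + d\<^sup>2 * L (g * g)"
      by (simp only: L_add L_smult)
    moreover have "0 < L (([:- c, 1:] * g) * ([:- c, 1:] * g))"
      by (intro L_sq_pos linear_mult_neq_0 \<open>g \<noteq> 0\<close>)
    ultimately show False
      using L_sq_nonneg[of g] by (smt (verit) mult_nonneg_nonneg zero_le_power2)
  qed
  define S where "S = {y. poly W y = 0}"
  have fin: "finite S" unfolding S_def by (rule poly_roots_finite) fact
  have card_S: "card S = Suc n"
    unfolding S_def using card_real_roots_eq_degree[OF \<open>W \<noteq> 0\<close> no_quadratic] deg_W by simp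
  have xS: "x \<in> S" by (simp add: S_def W_def)
  \<comment> \<open>The Lagrange basis at the nodes; the quadrature weights are the values
    \<open>L (l y)\<close>.\<close>
  define l where "l y = smult (1 / (\<Prod>z\<in>S - {y}. y - z)) (\<Prod>z\<in>S - {y}. [:- z, 1:])" for y
  have l: "poly (l y) z = (if y = z then 1 else 0)" if "y \<in> S" "z \<in> S" for y z
    using that fin by (auto simp: l_def poly_prod)
  have deg_l: "degree (l y) \<le> n" if "y \<in> S" for y
  proof -
    have "degree (\<Prod>z\<in>S - {y}. [:- z, 1:]) \<le> (\<Sum>z\<in>S - {y}. degree [:- z, 1:])"
      using degree_prod_sum_le[of "S - {y}" "\<lambda>z. [:- z, 1:]"] fin by (simp add: o_def)
    also have "\<dots> = n" using that fin card_S by simp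
    finally show ?thesis unfolding l_def using degree_smult_le order_trans by blast
  qed
  \<comment> \<open>Division by \<open>W\<close> gives a quotient of degree below \<open>n\<close>,
    which \<open>L_W\<close> annihilates, and a remainder of degree at most \<open>n\<close>, which
    is recovered by interpolation at the \<open>n + 1\<close> nodes.\<close>
  have quad: "L p = (\<Sum>y\<in>S. L (l y) * poly p y)" if "degree p \<le> 2 * n" for p
  proof -
    define q where "q = p div W"
    define r where "r = p mod W"
    have p: "p = W * q + r" by (simp add: q_def r_def)
    have deg_r: "degree r \<le> n"
      using degree_mod_less[OF \<open>W \<noteq> 0\<close>, of p] deg_W by (auto simp: r_def)
    have "q = 0 \<or> degree q < n"
    proof (rule ccontr)
      assume *: "\<not> ?thesis"
      then have "degree (W * q) = Suc n + degree q"
        using \<open>W \<noteq> 0\<close> deg_W by (subst degree_mult_eq) auto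
      with * deg_r have "degree p = Suc n + degree q"
        unfolding p by (subst degree_add_eq_left) auto
      with that * show False by simp
    qed
    then have "L p = L r" unfolding p by (simp add: L_add L_W)
    have "r = (\<Sum>y\<in>S. smult (poly r y) (l y))"
    proof (rule poly_eqI_degree[of S])
      show "poly r z = poly (\<Sum>y\<in>S. smult (poly r y) (l y)) z" if "z \<in> S" for z
        using that fin by (simp add: poly_sum l if_distrib sum.delta cong: if_cong)
      have "degree (\<Sum>y\<in>S. smult (poly r y) (l y)) \<le> n"
        using fin deg_l by (intro degree_sum_le) (auto intro: order_trans[OF degree_smult_le])
      then show "degree (\<Sum>y\<in>S. smult (poly r y) (l y)) < card S" using card_S by simp
    qed (use deg_r card_S in simp)
    then have "L r = (\<Sum>y\<in>S. poly r y * L (l y))"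
      by (metis (no_types, lifting) L_sum L_smult sum.cong)
    also have "\<dots> = (\<Sum>y\<in>S. L (l y) * poly p y)"
      by (intro sum.cong) (auto simp: p S_def)
    finally show ?thesis using \<open>L p = L r\<close> by simp
  qed
  \<comment> \<open>The square of \<open>l y\<close> has degree at most \<open>2 * n\<close> and the
    same values at the nodes as \<open>l y\<close>, so exactness identifies the weight with
    \<open>L (l y * l y)\<close>.\<close>
  have pos: "0 < L (l y)" if "y \<in> S" for y
  proof -
    have "degree (l y * l y) \<le> 2 * n"
      using degree_mult_le[of "l y" "l y"] deg_l[OF that] by simp
    then have "L (l y * l y) = (\<Sum>z\<in>S. L (l z) * poly (l y * l y) z)"
      by (rule quad)
    also have "\<dots> = L (l y)"
      using that fin by (simp add: l if_distrib sum.delta cong: if_cong)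
    finally have "L (l y) = L (l y * l y)" ..
    moreover have "l y \<noteq> 0" using l[OF that that] by auto
    ultimately show ?thesis using L_sq_pos by simp
  qed
  \<comment> \<open>\<open>L (k * k)\<close> is evaluated twice: the reproducing property gives
    \<open>poly k x\<close>, and quadrature gives only the term at \<open>x\<close>, because
    \<open>k\<close> vanishes at the other nodes.\<close>
  have "poly k x = L (k * k)"
    unfolding k_def by (rule L_kernel[symmetric]) (use deg_k k_def in simp)
  also have "\<dots> = (\<Sum>y\<in>S. L (l y) * poly (k * k) y)"
    by (rule quad) (use degree_mult_le[of k k] deg_k in simp)
  also have "\<dots> = (\<Sum>y\<in>S. if y = x then L (l x) * poly (k * k) x else 0)"
    by (intro sum.cong) (auto simp: S_def W_def)
  also have "\<dots> = L (l x) * poly (k * k) x"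
    using fin xS by simp
  finally have "L (l x) = 1 / poly k x"
    using kx by (simp add: field_simps)
  also have "poly k x = (\<Sum>k\<le>n. (poly (P k) x)\<^sup>2)"
    unfolding k_def by (simp add: poly_kernel power2_eq_square lessThan_Suc_atMost)
  finally have "L (l x) = 1 / (\<Sum>k\<le>n. (poly (P k) x)\<^sup>2)" .
  with fin xS pos quad show thesis
    by (rule that[of S "\<lambda>y. L (l y)"])
qed

end

section \<open>Weak limits of measures with converging moments\<close>

text \<open>Weak convergence controls only bounded continuous integrands, so powers are truncated.
  Fatou first bounds the even moments of the limit; these bounds then control the truncation error
  for the limit and the sequence alike.\<close>

lemma weak_limit_represents_moments:
  fixes \<nu> :: "nat \<Rightarrow> real measure" and s :: "nat \<Rightarrow> real"
  assumes dist: "\<And>n. real_distribution (\<nu> n)"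
    and int: "\<And>n k. integrable (\<nu> n) (\<lambda>x. x ^ k)"
    and moment: "\<And>k. \<forall>\<^sub>F n in sequentially. (\<integral>x. x ^ k \<partial>\<nu> n) = s k"
    and M: "real_distribution M" and conv: "weak_conv_m \<nu> M"
  shows "represents_moments M s"
proof -
  interpret M: real_distribution M by (rule M)
  interpret \<nu>: real_distribution "\<nu> n" for n by (rule dist)
  have lim: "(\<lambda>n. \<integral>x. f x \<partial>\<nu> n) \<longlonglongrightarrow> (\<integral>x. f x \<partial>M)"
    if "continuous_on UNIV f" "\<And>x. \<bar>f x\<bar> \<le> B" for f :: "real \<Rightarrow> real" and B
    using that by (intro weak_conv_imp_integral_bdd_continuous_conv[OF dist M conv])
      (auto simp: continuous_on_eq_continuous_at)
  \<comment> \<open>Cut at height \<open>j\<close>, the even power is bounded and continuous, and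
    its integral against \<open>M\<close> is at most \<open>s (2 * k)\<close>; Fatou removes the
    cut.\<close>
  have even_int: "integrable M (\<lambda>x. x ^ (2 * k))" and even_le: "(\<integral>x. x ^ (2 * k) \<partial>M) \<le> s (2 * k)" for k
  proof -
    let ?f = "\<lambda>j x :: real. min (x ^ (2 * k)) (real j)"
    have f_meas [measurable]: "?f j \<in> borel_measurable M" for j by measurable
    have f_le: "(\<integral>x. ?f j x \<partial>M) \<le> s (2 * k)" for j
    proof (rule tendsto_upperbound)
      show "(\<lambda>n. \<integral>x. ?f j x \<partial>\<nu> n) \<longlonglongrightarrow> (\<integral>x. ?f j x \<partial>M)"
        by (rule lim[of "?f j" "real j"]) (auto intro!: continuous_intros)
      show "\<forall>\<^sub>F n in sequentially. (\<integral>x. ?f j x \<partial>\<nu> n) \<le> s (2 * k)"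
        using moment[of "2 * k"]
      proof eventually_elim
        case (elim n)
        have "(\<integral>x. ?f j x \<partial>\<nu> n) \<le> (\<integral>x. x ^ (2 * k) \<partial>\<nu> n)"
          by (rule integral_mono[OF \<nu>.integrable_const_bound[where B = "real j"] int]) auto
        with elim show ?case by simp
      qed
    qed simp
    have int_f: "integrable M (?f j)" for j
      by (rule M.integrable_const_bound[where B = "real j"]) auto
    have pt: "(\<lambda>j. ?f j x) \<longlonglongrightarrow> x ^ (2 * k)" for x :: real
    proof (rule tendsto_eventually)
      show "\<forall>\<^sub>F j in sequentially. ?f j x = x ^ (2 * k)"
        using eventually_ge_at_top[of "nat \<lceil>x ^ (2 * k)\<rceil>"]
        by eventually_elim linarith
    qed
    have "(\<integral>\<^sup>+x. ennreal (x ^ (2 * k)) \<partial>M) \<le> liminf (\<lambda>j. \<integral>\<^sup>+x. ennreal (?f j x) \<partial>M)"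
    proof -
      have "(\<integral>\<^sup>+x. ennreal (x ^ (2 * k)) \<partial>M) = (\<integral>\<^sup>+x. liminf (\<lambda>j. ennreal (?f j x)) \<partial>M)"
        by (intro nn_integral_cong lim_imp_Liminf[symmetric] tendsto_ennrealI pt) auto
      also have "\<dots> \<le> liminf (\<lambda>j. \<integral>\<^sup>+x. ennreal (?f j x) \<partial>M)"
        by (rule nn_integral_liminf) measurable
      finally show ?thesis .
    qed
    also have "\<dots> \<le> ennreal (s (2 * k))"
    proof (rule Liminf_le)
      show "\<forall>\<^sub>F j in sequentially. (\<integral>\<^sup>+x. ennreal (?f j x) \<partial>M) \<le> ennreal (s (2 * k))"
        using f_le by (intro always_eventually allI) (simp add: nn_integral_eq_integral[OF int_f] ennreal_leI)
    qed simp
    finally have nn: "(\<integral>\<^sup>+x. ennreal (x ^ (2 * k)) \<partial>M) \<le> ennreal (s (2 * k))" .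
    show int: "integrable M (\<lambda>x. x ^ (2 * k))"
      by (rule integrableI_nonneg) (auto simp: le_less_trans[OF nn ennreal_less_top])
    have "0 \<le> s (2 * k)"
      by (rule order_trans[OF _ f_le[of 0]]) (auto intro!: integral_nonneg_AE)
    then show "(\<integral>x. x ^ (2 * k) \<partial>M) \<le> s (2 * k)"
      using nn by (simp add: nn_integral_eq_integral[OF int])
  qed
  have int_M: "integrable M (\<lambda>x. x ^ k)" for k
  proof (rule Bochner_Integration.integrable_bound)
    show "integrable M (\<lambda>x. 1 + x ^ (2 * k))"
      using even_int by simp
    have "\<bar>x ^ k\<bar> \<le> 1 + x ^ (2 * k)" for x :: real
    proof -
      have "2 * \<bar>x ^ k\<bar> \<le> 1 + (x ^ k)\<^sup>2"
        using sum_squares_bound[of 1 "\<bar>x ^ k\<bar>"] by simp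
      then show ?thesis by (simp add: power_mult[of x k 2] mult.commute)
    qed
    then show "AE x in M. norm (x ^ k) \<le> norm (1 + x ^ (2 * k))"
      by (intro AE_I2) (simp add: add_nonneg_nonneg)
  qed simp
  \<comment> \<open>Truncating \<open>x\<^sup>k\<close> at height \<open>R\<close> costs at most \<open>s (2k) / R\<close>, uniformly along the sequence.\<close>
  have trunc: "\<bar>(\<integral>x. x ^ k \<partial>N) - (\<integral>x. max (- R) (min (x ^ k) R) \<partial>N)\<bar> \<le> s (2 * k) / R"
    if N: "real_distribution N" and int: "\<And>k. integrable N (\<lambda>x. x ^ k)"
      and le: "(\<integral>x. x ^ (2 * k) \<partial>N) \<le> s (2 * k)" and R: "0 < R" for N k R
  proof -
    interpret N: real_distribution N by (rule N)
    have int_t: "integrable N (\<lambda>x. max (- R) (min (x ^ k) R))"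
      using R by (intro N.integrable_const_bound[where B = R]) auto
    have pt: "\<bar>y - max (- R) (min y R)\<bar> \<le> y\<^sup>2 / R" for y
    proof (cases "\<bar>y\<bar> \<le> R")
      case True
      then show ?thesis using R by (simp add: abs_le_iff)
    next
      case False
      then have "\<bar>y - max (- R) (min y R)\<bar> \<le> \<bar>y\<bar>" using R by linarith
      also have "\<bar>y\<bar> * R \<le> \<bar>y\<bar> * \<bar>y\<bar>" using False by (intro mult_left_mono) auto
      then have "\<bar>y\<bar> \<le> y\<^sup>2 / R" using R by (simp add: pos_le_divide_eq power2_eq_square abs_mult[symmetric])
      finally show ?thesis .
    qed
    have "\<bar>(\<integral>x. x ^ k \<partial>N) - (\<integral>x. max (- R) (min (x ^ k) R) \<partial>N)\<bar>
        = \<bar>\<integral>x. x ^ k - max (- R) (min (x ^ k) R) \<partial>N\<bar>"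
      by (simp add: int int_t)
    also have "\<dots> \<le> (\<integral>x. \<bar>x ^ k - max (- R) (min (x ^ k) R)\<bar> \<partial>N)"
      by (rule integral_abs_bound)
    also have "\<dots> \<le> (\<integral>x. x ^ (2 * k) / R \<partial>N)"
      using pt[of "_ ^ k"] int int_t
      by (intro integral_mono) (auto simp: power_mult[symmetric] mult.commute)
    also have "\<dots> \<le> s (2 * k) / R"
      using le R by (simp add: divide_right_mono)
    finally show ?thesis .
  qed
  have "(\<integral>x. x ^ k \<partial>M) = s k" for k
  proof -
    \<comment> \<open>The factor 2 collects one truncation error from the sequence and one from the
      limit; afterwards \<open>R\<close> tends to infinity.\<close>
    have le: "\<bar>(\<integral>x. x ^ k \<partial>M) - s k\<bar> \<le> 2 * s (2 * k) / R" if R: "0 < R" for R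
    proof -
      let ?t = "\<lambda>x :: real. max (- R) (min (x ^ k) R)"
      have "(\<lambda>n. \<bar>(\<integral>x. ?t x \<partial>\<nu> n) - s k\<bar>) \<longlonglongrightarrow> \<bar>(\<integral>x. ?t x \<partial>M) - s k\<bar>"
        using R by (intro tendsto_intros lim[of ?t R]) (auto intro!: continuous_intros)
      moreover have "\<forall>\<^sub>F n in sequentially. \<bar>(\<integral>x. ?t x \<partial>\<nu> n) - s k\<bar> \<le> s (2 * k) / R"
        using moment[of k] moment[of "2 * k"]
      proof eventually_elim
        case (elim n)
        then show ?case using trunc[OF dist int _ R, of n k] by (simp add: abs_minus_commute)
      qed
      ultimately have "\<bar>(\<integral>x. ?t x \<partial>M) - s k\<bar> \<le> s (2 * k) / R"
        by (rule tendsto_upperbound) simp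
      then show ?thesis
        using trunc[OF M int_M even_le R, of k] by (simp add: abs_le_iff)
    qed
    have "((\<lambda>R. 2 * s (2 * k) / R) \<longlongrightarrow> 0) at_top"
      by (intro tendsto_divide_0[OF tendsto_const] filterlim_at_top_imp_at_infinity filterlim_ident)
    then have "\<bar>(\<integral>x. x ^ k \<partial>M) - s k\<bar> \<le> 0"
      by (rule tendsto_lowerbound) (auto intro!: eventually_mono[OF eventually_gt_at_top[of 0]] le)
    then show ?thesis by simp
  qed
  with int_M show ?thesis
    by (simp add: represents_moments_def)
qed

text \<open>The indicator of a point is not continuous, so it is dominated by tent functions
  \<open>g j\<close>. The bound passes to the weak limit for each \<open>j\<close>, and then
  dominated convergence shrinks the tents to the point.\<close>

lemma weak_limit_atom_ge:
  assumes dist: "\<And>n. real_distribution (\<nu> n)" and M: "real_distribution M"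
    and conv: "weak_conv_m \<nu> M" and atom: "\<And>n. c \<le> measure (\<nu> n) {x}"
  shows "c \<le> measure M {x}"
proof -
  interpret M: real_distribution M by (rule M)
  interpret \<nu>: real_distribution "\<nu> n" for n by (rule dist)
  define g where "g j y = max 0 (1 - real j * \<bar>y - x\<bar>)" for j y
  have g_cont: "continuous_on UNIV (g j)" for j
    unfolding g_def by (intro continuous_intros)
  have g_meas [measurable]: "g j \<in> borel_measurable borel" for j
    using g_cont by (rule borel_measurable_continuous_onI)
  have g01: "0 \<le> g j y" "g j y \<le> 1" for j y by (auto simp: g_def)
  have "c \<le> (\<integral>y. g j y \<partial>M)" for j
  proof (rule tendsto_lowerbound)
    show "(\<lambda>n. \<integral>y. g j y \<partial>\<nu> n) \<longlonglongrightarrow> (\<integral>y. g j y \<partial>M)"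
      using g_cont[of j] g01 by (intro weak_conv_imp_integral_bdd_continuous_conv[OF dist M conv, where B = 1])
        (auto simp: continuous_on_eq_continuous_at)
    show "\<forall>\<^sub>F n in sequentially. c \<le> (\<integral>y. g j y \<partial>\<nu> n)"
    proof (intro always_eventually allI)
      fix n
      have "c \<le> (\<integral>y. indicator {x} y \<partial>\<nu> n)" using atom by simp
      also have "\<dots> \<le> (\<integral>y. g j y \<partial>\<nu> n)"
      proof (rule integral_mono)
        show "integrable (\<nu> n) (g j)"
          using g01 by (intro \<nu>.integrable_const_bound[where B = 1]) auto
        show "indicator {x} y \<le> g j y" for y
          using g01 by (auto simp: g_def indicator_def)
      qed (auto simp: integrable_indicator_iff less_top[symmetric])
      finally show "c \<le> (\<integral>y. g j y \<partial>\<nu> n)" .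
    qed
  qed simp
  moreover have "(\<lambda>j. \<integral>y. g j y \<partial>M) \<longlonglongrightarrow> (\<integral>y. indicator {x} y \<partial>M)"
  proof (rule integral_dominated_convergence[where w = "\<lambda>_. 1"])
    show "AE y in M. (\<lambda>j. g j y) \<longlonglongrightarrow> indicator {x} y"
    proof (rule AE_I2)
      fix y
      show "(\<lambda>j. g j y) \<longlonglongrightarrow> indicator {x} y"
      proof (cases "y = x")
        case False
        have "\<forall>\<^sub>F j in sequentially. 1 / \<bar>y - x\<bar> \<le> real j"
          using filterlim_real_sequentially by (simp add: filterlim_at_top)
        then have "\<forall>\<^sub>F j in sequentially. g j y = 0"
          by eventually_elim (use False in \<open>simp add: g_def field_simps\<close>)
        then show ?thesis using False by (intro tendsto_eventually) simp
      qed (simp add: g_def)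
    qed
  qed (use g01 in auto)
  ultimately have "c \<le> (\<integral>y. indicator {x} y \<partial>M)"
    by (intro tendsto_lowerbound) auto
  then show ?thesis by simp
qed

text \<open>Chebyshev's inequality with a bound uniform in \<open>n\<close>.\<close>

lemma tight_of_second_moment:
  assumes dist: "\<And>n. real_distribution (\<nu> n)"
    and int: "\<And>n. integrable (\<nu> n) (\<lambda>x. x\<^sup>2)"
    and le: "\<And>n. (\<integral>x. x\<^sup>2 \<partial>\<nu> n) \<le> c"
  shows "tight \<nu>"
  unfolding tight_def
proof (intro conjI allI impI dist)
  fix \<epsilon> :: real assume \<epsilon>: "0 < \<epsilon>"
  interpret \<nu>: real_distribution "\<nu> n" for n by (rule dist)
  have "0 \<le> (\<integral>x. x\<^sup>2 \<partial>\<nu> 0)" by (rule integral_nonneg_AE) auto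
  then have c: "0 \<le> c" using le[of 0] by linarith
  \<comment> \<open>The summand 1 gives \<open>R > 1\<close> and so
    \<open>R \<le> R\<^sup>2\<close>, while \<open>\<epsilon> * R = c + 1 + \<epsilon>\<close>
    exceeds \<open>c\<close>; together \<open>c / R\<^sup>2 < \<epsilon>\<close>.\<close>
  define R where "R = (c + 1) / \<epsilon> + 1"
  have "0 < (c + 1) / \<epsilon>" using c \<epsilon> by simp
  then have R: "1 < R" by (simp add: R_def)
  then have "R \<le> R\<^sup>2" by (simp add: self_le_power)
  have cR: "c < \<epsilon> * R\<^sup>2"
  proof -
    have "\<epsilon> * R = c + 1 + \<epsilon>" using \<epsilon> by (simp add: R_def field_simps)
    then have "c < \<epsilon> * R" using \<epsilon> by linarith
    also have "\<dots> \<le> \<epsilon> * R\<^sup>2" using \<open>R \<le> R\<^sup>2\<close> \<epsilon> by (intro mult_left_mono) auto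
    finally show ?thesis .
  qed
  have "1 - \<epsilon> < measure (\<nu> n) {- R<..R}" for n
  proof -
    have "measure (\<nu> n) {x \<in> space (\<nu> n). R\<^sup>2 \<le> x\<^sup>2} \<le> (\<integral>x. x\<^sup>2 \<partial>\<nu> n) / R\<^sup>2"
      by (rule integral_Markov_inequality_measure[OF int, of UNIV]) (use R in auto)
    also have "\<dots> \<le> c / R\<^sup>2"
      using le by (intro divide_right_mono) auto
    also have "\<dots> < \<epsilon>"
      using cR R by (simp add: field_simps)
    finally have *: "measure (\<nu> n) {x. R\<^sup>2 \<le> x\<^sup>2} < \<epsilon>" by simp
    have "measure (\<nu> n) (- {- R<..R}) \<le> measure (\<nu> n) {x. R\<^sup>2 \<le> x\<^sup>2}"
    proof (rule \<nu>.finite_measure_mono)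
      show "- {- R<..R} \<subseteq> {x. R\<^sup>2 \<le> x\<^sup>2}"
        using R by (auto simp: abs_le_square_iff[symmetric])
    qed simp
    moreover have "measure (\<nu> n) (- {- R<..R}) = 1 - measure (\<nu> n) {- R<..R}"
      using \<nu>.prob_compl[of "{- R<..R}"] by (simp add: Compl_eq_Diff_UNIV)
    ultimately show ?thesis using * by linarith
  qed
  then show "\<exists>a b. a < b \<and> (\<forall>n. 1 - \<epsilon> < measure (\<nu> n) {a<..b})"
    using R by (intro exI[of _ "- R"] exI[of _ R]) auto
qed

text \<open>The point measure lives on \<open>S\<close> alone; its pushforward along the identity is
  a Borel measure on the whole line, as weak convergence requires.\<close>

lemma finite_atomic_distribution:
  fixes S :: "real set" and \<omega> :: "real \<Rightarrow> real"
  assumes fin: "finite S" and nonneg: "\<And>x. x \<in> S \<Longrightarrow> 0 \<le> \<omega> x" and sum: "(\<Sum>x\<in>S. \<omega> x) = 1"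
  defines "\<nu> \<equiv> distr (point_measure S \<omega>) borel (\<lambda>x. x)"
  shows "real_distribution \<nu>"
    and "integrable \<nu> (\<lambda>x. x ^ k)"
    and "(\<integral>x. x ^ k \<partial>\<nu>) = (\<Sum>x\<in>S. \<omega> x * x ^ k)"
    and "x \<in> S \<Longrightarrow> measure \<nu> {x} = \<omega> x"
proof -
  have meas [measurable]: "(\<lambda>x. x) \<in> measurable (point_measure S \<omega>) borel"
    by simp
  have "emeasure (point_measure S \<omega>) (space (point_measure S \<omega>)) = 1"
    using assms by (simp add: emeasure_point_measure_finite space_point_measure sum_ennreal)
  then have "prob_space (point_measure S \<omega>)" by (rule prob_spaceI)
  then have "prob_space \<nu>"
    unfolding \<nu>_def by (rule prob_space.prob_space_distr) simp
  then show "real_distribution \<nu>"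
    unfolding real_distribution_def real_distribution_axioms_def by (simp add: \<nu>_def)
  show "integrable \<nu> (\<lambda>x. x ^ k)"
    unfolding \<nu>_def using fin by (subst integrable_distr_eq) (auto intro: integrable_point_measure_finite)
  show "(\<integral>x. x ^ k \<partial>\<nu>) = (\<Sum>x\<in>S. \<omega> x * x ^ k)"
    unfolding \<nu>_def using fin nonneg by (subst integral_distr) (auto simp: lebesgue_integral_point_measure_finite)
  show "measure \<nu> {x} = \<omega> x" if "x \<in> S"
    unfolding \<nu>_def using fin nonneg that
    by (subst measure_distr) (auto simp: measure_point_measure_finite_if space_point_measure)
qed

section \<open>Representing measures with a prescribed atom\<close>

context moment_functional
begin

text \<open>Quadrature measures with node \<open>x\<close> match ever more moments and have mass at
  \<open>x\<close> bounded below. A bounded second moment makes them tight, and both properties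
  survive in a weak subsequential limit.\<close>

lemma representing_measure_with_atom:
  assumes summable: "summable (\<lambda>n. (poly (P n) x)\<^sup>2)" and "s 0 = 1"
  obtains M where "represents_moments M s" "1 / (\<Sum>n. (poly (P n) x)\<^sup>2) \<le> measure M {x}"
proof -
  define c where "c = 1 / (\<Sum>n. (poly (P n) x)\<^sup>2)"
  have "\<exists>\<nu>. real_distribution \<nu> \<and> (\<forall>k. integrable \<nu> (\<lambda>x. x ^ k)) \<and>
      (\<forall>k\<le>2 * n. (\<integral>x. x ^ k \<partial>\<nu>) = s k) \<and> c \<le> measure \<nu> {x}" for n
  proof -
    \<comment> \<open>The quadrature of index \<open>m\<close> needs \<open>P m\<close> nonzero at
      \<open>x\<close>, which happens for arbitrarily large \<open>m\<close>.\<close>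
    obtain m where m: "n \<le> m" "poly (P m) x \<noteq> 0"
      by (rule frequently_P_nonzero)
    obtain S \<omega> where S: "finite S" "x \<in> S" and pos: "\<And>y. y \<in> S \<Longrightarrow> 0 < \<omega> y"
      and quad: "\<And>p. degree p \<le> 2 * m \<Longrightarrow> L p = (\<Sum>y\<in>S. \<omega> y * poly p y)"
      and \<omega>x: "\<omega> x = 1 / (\<Sum>k\<le>m. (poly (P k) x)\<^sup>2)"
      by (rule gauss_quadrature[OF m(2)], rule that)
    have mom: "s k = (\<Sum>y\<in>S. \<omega> y * y ^ k)" if "k \<le> 2 * m" for k
      using quad[of "monom 1 k"] that by (simp add: L_monom poly_monom degree_monom_eq)
    have sum: "(\<Sum>y\<in>S. \<omega> y) = 1"
      using mom[of 0] \<open>s 0 = 1\<close> by simp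
    note \<nu> = finite_atomic_distribution[OF S(1) less_imp_le[OF pos] sum]
    have "0 < \<omega> x" using pos S(2) .
    then have "0 < (\<Sum>k\<le>m. (poly (P k) x)\<^sup>2)"
      unfolding \<omega>x by (simp add: zero_less_divide_iff)
    moreover have "(\<Sum>k\<le>m. (poly (P k) x)\<^sup>2) \<le> (\<Sum>n. (poly (P n) x)\<^sup>2)"
      by (rule sum_le_suminf[OF summable]) auto
    ultimately have "c \<le> \<omega> x"
      unfolding c_def \<omega>x by (intro frac_le) auto
    with \<nu>(1,2,4) S(2) \<nu>(3) mom m(1) show ?thesis
      by (intro exI[of _ "distr (point_measure S \<omega>) borel (\<lambda>x. x)"]) auto
  qed
  then obtain \<nu> where \<nu>: "\<And>n. real_distribution (\<nu> n)" "\<And>n k. integrable (\<nu> n) (\<lambda>x. x ^ k)"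
      "\<And>n k. k \<le> 2 * n \<Longrightarrow> (\<integral>x. x ^ k \<partial>\<nu> n) = s k" "\<And>n. c \<le> measure (\<nu> n) {x}"
    by metis
  \<comment> \<open>The shift by one makes every measure in the sequence have second moment exactly
    \<open>s 2\<close>.\<close>
  define \<nu>' where "\<nu>' n = \<nu> (Suc n)" for n
  have "tight \<nu>'"
    by (rule tight_of_second_moment[where c = "s 2"]) (simp_all add: \<nu>'_def \<nu>)
  from tight_imp_convergent_subsubsequence[OF this strict_mono_id]
  obtain r M where r: "strict_mono r" and M: "real_distribution M" and conv: "weak_conv_m (\<nu>' \<circ> id \<circ> r) M"
    by blast
  let ?\<nu> = "\<nu>' \<circ> id \<circ> r"
  have "represents_moments M s"
  proof (rule weak_limit_represents_moments[OF _ _ _ M conv])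
    show "\<forall>\<^sub>F n in sequentially. (\<integral>x. x ^ k \<partial>?\<nu> n) = s k" for k
      using eventually_ge_at_top[of k]
    proof eventually_elim
      case (elim n)
      then have "k \<le> 2 * Suc (r n)"
        using seq_suble[OF r, of n] by simp
      then show ?case by (simp add: \<nu>'_def \<nu>(3))
    qed
  qed (simp_all add: \<nu>'_def \<nu>)
  moreover have "c \<le> measure M {x}"
    by (rule weak_limit_atom_ge[OF _ M conv]) (simp_all add: \<nu>'_def \<nu>)
  ultimately show thesis
    using that unfolding c_def by blast
qed

text \<open>In the determinate case every measure with a prescribed atom is \<open>\<mu>\<close>
  itself, so \<open>\<mu>\<close> has mass at least \<open>1 / B\<close> at each point of
  \<open>X\<close>; more than \<open>B\<close> such points exceed total mass 1.\<close>

lemma indeterminate_if_bounded_on_infinite_set: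
  assumes "prob_space \<mu>" and "infinite X"
    and summable: "\<And>x. x \<in> X \<Longrightarrow> summable (\<lambda>n. (poly (P n) x)\<^sup>2)"
    and bound: "\<And>x. x \<in> X \<Longrightarrow> (\<Sum>n. (poly (P n) x)\<^sup>2) \<le> B"
  shows "indeterminate s"
proof (rule ccontr)
  assume det: "\<not> indeterminate s"
  interpret prob_space \<mu> by fact
  have sets: "sets \<mu> = sets borel" and s0: "s 0 = 1"
    using moments unfolding represents_moments_def by (auto simp: prob_space dest: spec[of _ 0])
  have pos: "0 < (\<Sum>n. (poly (P n) x)\<^sup>2)" if "x \<in> X" for x
  proof -
    obtain n where "poly (P n) x \<noteq> 0" by (rule frequently_P_nonzero)
    then show ?thesis by (intro suminf_pos2[OF summable[OF that]]) auto
  qed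
  have atom: "1 / B \<le> measure \<mu> {x}" if x: "x \<in> X" for x
  proof -
    obtain M where "represents_moments M s" and M: "1 / (\<Sum>n. (poly (P n) x)\<^sup>2) \<le> measure M {x}"
      using representing_measure_with_atom[OF summable[OF x] s0] .
    with det moments have "M = \<mu>" unfolding indeterminate_def by blast
    moreover have "1 / B \<le> 1 / (\<Sum>n. (poly (P n) x)\<^sup>2)"
      using bound[OF x] pos[OF x] by (intro frac_le) auto
    ultimately show ?thesis using M by simp
  qed
  obtain x where "x \<in> X" using \<open>infinite X\<close> by (metis finite.emptyI ex_in_conv)
  then have "0 < B" using pos bound by fastforce
  obtain F where F: "F \<subseteq> X" "finite F" "card F = nat \<lceil>B\<rceil> + 1"
    using infinite_arbitrarily_large[OF \<open>infinite X\<close>] by blast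
  have "1 < real (card F) / B"
    using F(3) \<open>0 < B\<close> by (simp add: field_simps) linarith
  also have "real (card F) / B = (\<Sum>x\<in>F. 1 / B)" by simp
  also have "\<dots> \<le> (\<Sum>x\<in>F. measure \<mu> {x})"
    using F(1) by (intro sum_mono atom) auto
  also have "\<dots> = measure \<mu> F"
    using F(2) by (intro finite_measure_eq_sum_singleton[symmetric]) (auto simp: sets)
  finally show False using prob_le_1[of F] by linarith
qed

end

section \<open>Growth of the solutions of the recurrence\<close>

lemma solves_recurrence_cpoly_0:
  assumes "solves_recurrence a b c r"
  shows "z * cpoly (r 0) z = b 0 * cpoly (r 1) z + a 0 * cpoly (r 0) z + of_real c"
  using arg_cong[OF assms[unfolded solves_recurrence_def, rule_format, of 0], of "\<lambda>p. cpoly p z"]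
  by simp

lemma solves_recurrence_cpoly_Suc:
  assumes "solves_recurrence a b c r"
  shows "z * cpoly (r (Suc n)) z
    = b (Suc n) * cpoly (r (Suc (Suc n))) z + a (Suc n) * cpoly (r (Suc n)) z + b n * cpoly (r n) z"
  using arg_cong[OF assms[unfolded solves_recurrence_def, rule_format, of "Suc n"], of "\<lambda>p. cpoly p z"]
  by simp

lemma solves_recurrence_at_0:
  assumes "solves_recurrence a b c r"
  shows "b 0 * poly (r 1) 0 + a 0 * poly (r 0) 0 + c = 0"
    and "b (Suc n) * poly (r (Suc (Suc n))) 0 + a (Suc n) * poly (r (Suc n)) 0 + b n * poly (r n) 0 = 0"
proof -
  have "complex_of_real (b 0 * poly (r 1) 0 + a 0 * poly (r 0) 0 + c) = 0"
    using solves_recurrence_cpoly_0[OF assms, of 0] by (simp add: cpoly_at_0)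
  then show "b 0 * poly (r 1) 0 + a 0 * poly (r 0) 0 + c = 0"
    by (simp only: of_real_eq_0_iff)
  have "complex_of_real (b (Suc n) * poly (r (Suc (Suc n))) 0 + a (Suc n) * poly (r (Suc n)) 0
      + b n * poly (r n) 0) = 0"
    using solves_recurrence_cpoly_Suc[OF assms, of 0 n] by (simp add: cpoly_at_0)
  then show "b (Suc n) * poly (r (Suc (Suc n))) 0 + a (Suc n) * poly (r (Suc n)) 0 + b n * poly (r n) 0 = 0"
    by (simp only: of_real_eq_0_iff)
qed

section \<open>Elementary inequalities for powers and exponentials\<close>

lemma powr_add_le_add_powr:
  fixes x y \<alpha> :: real
  assumes "0 \<le> x" "0 \<le> y" "0 < \<alpha>" "\<alpha> \<le> 1"
  shows "(x + y) powr \<alpha> \<le> x powr \<alpha> + y powr \<alpha>"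
proof (cases "x + y = 0")
  case False
  have *: "t \<le> t powr \<alpha>" if "0 \<le> t" "t \<le> 1" for t :: real
    using that assms powr_mono'[of \<alpha> 1 t] by simp
  \<comment> \<open>Both fractions lie in the unit interval, so raising them to the power
    \<open>\<alpha>\<close> does not decrease them; clearing the denominator gives the
    claim.\<close>
  have "1 = x / (x + y) + y / (x + y)"
    using False by (simp flip: add_divide_distrib)
  also have "\<dots> \<le> (x / (x + y)) powr \<alpha> + (y / (x + y)) powr \<alpha>"
    using assms False by (intro add_mono *) auto
  also have "\<dots> = (x powr \<alpha> + y powr \<alpha>) / (x + y) powr \<alpha>"
    using assms by (simp add: powr_divide add_divide_distrib)
  finally show ?thesis
    using assms False by (simp add: pos_le_divide_eq)
qed (use assms in simp)

text \<open>Subadditivity bounds \<open>(1 + x) powr \<alpha>\<close> by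
  \<open>1 + x powr \<alpha>\<close>, hence by \<open>exp (x powr \<alpha>)\<close>; taking the
  power \<open>1 / \<alpha>\<close> produces the denominator.\<close>

lemma one_plus_le_exp_powr:
  fixes x \<alpha> :: real
  assumes "0 \<le> x" "0 < \<alpha>" "\<alpha> \<le> 1"
  shows "1 + x \<le> exp (x powr \<alpha> / \<alpha>)"
proof -
  have "(1 + x) powr \<alpha> \<le> 1 + x powr \<alpha>"
    using powr_add_le_add_powr[of 1 x \<alpha>] assms by simp
  also have "\<dots> \<le> exp (x powr \<alpha>)"
    by (rule exp_ge_add_one_self)
  finally have "((1 + x) powr \<alpha>) powr (1 / \<alpha>) \<le> exp (x powr \<alpha>) powr (1 / \<alpha>)"
    using assms by (intro powr_mono2) auto
  then show ?thesis
    using assms by (simp add: powr_powr exp_powr_real)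
qed

lemma eventually_powr_ge:
  fixes c p :: real
  assumes "0 < p"
  shows "\<forall>\<^sub>F R in at_top. c \<le> R powr p"
proof -
  have "filterlim (\<lambda>R::real. R powr p) at_top at_top"
    using assms by real_asymp
  then show ?thesis by (simp add: filterlim_at_top)
qed

lemma cmod_sq_powr: "(cmod x)\<^sup>2 powr \<alpha> = cmod x powr (2 * \<alpha>)"
proof -
  have "(cmod x)\<^sup>2 = cmod x powr 2" by simp
  then show ?thesis by (simp only: powr_powr)
qed

section \<open>Wronskian, variation of constants and the product bound\<close>

locale jacobi_recurrence =
  fixes a b :: "nat \<Rightarrow> real" and P Q :: "nat \<Rightarrow> real poly"
  assumes coeffs: "recurrence_coeffs a b P" and second_kind: "second_kind_polys a b Q"
begin

lemma b_pos: "b n > 0" and P_0: "P 0 = 1" and P_rec: "solves_recurrence a b 0 P"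
  using coeffs unfolding recurrence_coeffs_def by auto

lemma Q_0: "Q 0 = 0" and Q_rec: "solves_recurrence a b (-1) Q"
  using second_kind unfolding second_kind_polys_def by auto

definition u :: "nat \<Rightarrow> real" where "u n = poly (P n) 0"
definition v :: "nat \<Rightarrow> real" where "v n = poly (Q n) 0"
definition w :: "nat \<Rightarrow> real" where "w n = (u n)\<^sup>2 + (v n)\<^sup>2"

lemma w_nonneg: "0 \<le> w n"
  by (simp add: w_def)

lemma u_rec:
  "b 0 * u 1 + a 0 * u 0 = 0"
  "b (Suc n) * u (Suc (Suc n)) + a (Suc n) * u (Suc n) + b n * u n = 0"
  unfolding u_def
  using solves_recurrence_at_0(1)[OF P_rec] solves_recurrence_at_0(2)[OF P_rec, of n] by simp_all

lemma v_rec: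
  "b 0 * v 1 + a 0 * v 0 = 1"
  "b (Suc n) * v (Suc (Suc n)) + a (Suc n) * v (Suc n) + b n * v n = 0"
  unfolding v_def
  using solves_recurrence_at_0(1)[OF Q_rec] solves_recurrence_at_0(2)[OF Q_rec, of n] by simp_all

lemma u_0 [simp]: "u 0 = 1" and v_0 [simp]: "v 0 = 0"
  by (simp_all add: u_def v_def P_0 Q_0)

text \<open>Combining the two recurrences crosswise cancels the \<open>a\<close> terms, so the
  expression does not depend on \<open>n\<close>; its value comes from the initial data at
  \<open>n = 0\<close>.\<close>

lemma wronskian: "b n * (u n * v (Suc n) - u (Suc n) * v n) = 1"
proof (induction n)
  case 0
  then show ?case using v_rec(1) by simp
next
  case (Suc n)
  have "b (Suc n) * (u (Suc n) * v (Suc (Suc n)) - u (Suc (Suc n)) * v (Suc n))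
    = u (Suc n) * (b (Suc n) * v (Suc (Suc n)) + a (Suc n) * v (Suc n) + b n * v n)
      - v (Suc n) * (b (Suc n) * u (Suc (Suc n)) + a (Suc n) * u (Suc n) + b n * u n)
      + b n * (u n * v (Suc n) - u (Suc n) * v n)"
    by (simp add: algebra_simps)
  then show ?case
    by (simp only: u_rec v_rec Suc.IH)
qed

text \<open>
  Variation of constants: the pair is \<open>(A\<^sub>n, B\<^sub>n)\<close> with
  \<open>r\<^sub>n(z) = P\<^sub>n(0) A\<^sub>n + Q\<^sub>n(0) B\<^sub>n\<close>, and its increments have rank one.
\<close>

definition AB :: "(nat \<Rightarrow> real poly) \<Rightarrow> complex \<Rightarrow> complex \<Rightarrow> complex \<Rightarrow> nat \<Rightarrow> complex \<times> complex"
  where "AB r A\<^sub>0 B\<^sub>0 z n =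
    (A\<^sub>0 - z * (\<Sum>k<n. v k * cpoly (r k) z), B\<^sub>0 + z * (\<Sum>k<n. u k * cpoly (r k) z))"

text \<open>At \<open>z\<close> the recurrence is the one at 0 with forcing term
  \<open>z * r n\<close>, and the increments of the pair reproduce this forcing through the
  Wronskian. The choice \<open>B\<^sub>0 = - c\<close> reflects that the reference solutions have
  values 0 and -1 at index -1.\<close>

lemma variation_of_constants:
  assumes r: "solves_recurrence a b c r" and r0: "cpoly (r 0) z = A\<^sub>0" and c: "B\<^sub>0 = - of_real c"
  shows "cpoly (r n) z = u n * fst (AB r A\<^sub>0 B\<^sub>0 z n) + v n * snd (AB r A\<^sub>0 B\<^sub>0 z n)"
proof -
  let ?R = "\<lambda>n. cpoly (r n) z"
  let ?A = "\<lambda>n. fst (AB r A\<^sub>0 B\<^sub>0 z n)" and ?B = "\<lambda>n. snd (AB r A\<^sub>0 B\<^sub>0 z n)"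
  have A_Suc: "?A (Suc n) = ?A n - z * v n * ?R n"
    and B_Suc: "?B (Suc n) = ?B n + z * u n * ?R n" for n
    by (simp_all add: AB_def algebra_simps)
  have bnz: "complex_of_real (b n) \<noteq> 0" for n
    using b_pos[of n] by simp
  have wr: "of_real (b n) * (of_real (u n) * of_real (v (Suc n)) - of_real (u (Suc n)) * of_real (v n)) = (1::complex)" for n
    using arg_cong[OF wronskian, of complex_of_real n] by simp
  \<comment> \<open>The increments contribute \<open>z * ?R n\<close> times the Wronskian
    expression, which equals 1.\<close>
  have step: "of_real (b n) * (u (Suc n) * ?A (Suc n) + v (Suc n) * ?B (Suc n))
      = of_real (b n * u (Suc n)) * ?A n + of_real (b n * v (Suc n)) * ?B n + z * ?R n" for n
  proof -
    have "of_real (b n) * (u (Suc n) * ?A (Suc n) + v (Suc n) * ?B (Suc n))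
      = of_real (b n * u (Suc n)) * ?A n + of_real (b n * v (Suc n)) * ?B n
        + z * ?R n * (of_real (b n) * (of_real (u n) * of_real (v (Suc n)) - of_real (u (Suc n)) * of_real (v n)))"
      unfolding A_Suc B_Suc by (simp add: algebra_simps)
    then show ?thesis by (simp only: wr mult_1_right)
  qed
  \<comment> \<open>The recurrence is of second order, so the induction carries two consecutive
    indices.\<close>
  have "?R n = u n * ?A n + v n * ?B n \<and> ?R (Suc n) = u (Suc n) * ?A (Suc n) + v (Suc n) * ?B (Suc n)"
  proof (induction n)
    case 0
    have R0: "?R 0 = u 0 * ?A 0 + v 0 * ?B 0"
      by (simp add: AB_def r0)
    have 1: "b 0 * u (Suc 0) = - a 0 * u 0" "b 0 * v (Suc 0) = 1 - a 0 * v 0"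
      using u_rec(1) v_rec(1) by simp_all
    have "of_real (b 0) * (u (Suc 0) * ?A (Suc 0) + v (Suc 0) * ?B (Suc 0))
      = of_real (- a 0 * u 0) * ?A 0 + of_real (1 - a 0 * v 0) * ?B 0 + z * ?R 0"
      unfolding step 1 ..
    also have "\<dots> = of_real (b 0) * ?R (Suc 0)"
      using solves_recurrence_cpoly_0[OF r, of z] c R0 by (simp add: AB_def algebra_simps)
    finally show ?case using R0 bnz by simp
  next
    case (Suc n)
    \<comment> \<open>Advancing the pair from \<open>n\<close> to \<open>n + 1\<close> leaves the
      combination at index \<open>n\<close> unchanged, since the two increments cancel against the
      weights \<open>u n\<close> and \<open>v n\<close>.\<close>
    have *: "u n * ?A (Suc n) + v n * ?B (Suc n) = ?R n"
      unfolding A_Suc B_Suc using Suc by (simp add: algebra_simps)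
    have 1: "b (Suc n) * u (Suc (Suc n)) = - a (Suc n) * u (Suc n) - b n * u n"
      "b (Suc n) * v (Suc (Suc n)) = - a (Suc n) * v (Suc n) - b n * v n"
      using u_rec(2)[of n] v_rec(2)[of n] by linarith+
    have "of_real (b (Suc n)) * (u (Suc (Suc n)) * ?A (Suc (Suc n)) + v (Suc (Suc n)) * ?B (Suc (Suc n)))
      = - a (Suc n) * (u (Suc n) * ?A (Suc n) + v (Suc n) * ?B (Suc n))
        - b n * (u n * ?A (Suc n) + v n * ?B (Suc n)) + z * ?R (Suc n)"
      unfolding step 1 by (simp add: algebra_simps)
    also have "\<dots> = of_real (b (Suc n)) * ?R (Suc (Suc n))"
      unfolding * using Suc solves_recurrence_cpoly_Suc[OF r, of z n] by (simp add: algebra_simps)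
    finally show ?case using Suc bnz by simp
  qed
  then show ?thesis by blast
qed

lemma cmod_combination_le:
  "cmod (of_real (u n) * A + of_real (v n) * B) \<le> sqrt (w n) * norm (A, B)"
proof -
  have "cmod (of_real (u n) * A + of_real (v n) * B) \<le> \<bar>u n\<bar> * cmod A + \<bar>v n\<bar> * cmod B"
    by (rule order_trans[OF norm_triangle_ineq]) (simp add: norm_mult)
  also have "\<dots> = inner (\<bar>u n\<bar>, \<bar>v n\<bar>) (cmod A, cmod B)"
    by simp
  also have "\<dots> \<le> norm (\<bar>u n\<bar>, \<bar>v n\<bar>) * norm (cmod A, cmod B)"
    by (rule norm_cauchy_schwarz)
  finally show ?thesis by (simp add: norm_Pair w_def)
qed

text \<open>The increment of the pair is \<open>z * r n\<close> times the vector
  \<open>(- v n, u n)\<close> of norm \<open>sqrt (w n)\<close>, and \<open>r n\<close> itself is at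
  most \<open>sqrt (w n)\<close> times the norm of the pair. This gives one factor
  \<open>1 + cmod z * w n\<close> per step.\<close>

lemma solution_bound:
  fixes A\<^sub>0 B\<^sub>0 :: complex
  assumes r: "solves_recurrence a b c r" and r0: "cpoly (r 0) z = A\<^sub>0" and c: "B\<^sub>0 = - of_real c"
    and init: "norm (A\<^sub>0, B\<^sub>0) \<le> 1"
  shows "cmod (cpoly (r n) z) \<le> sqrt (w n) * (\<Prod>k<n. 1 + cmod z * w k)"
proof -
  let ?E = "\<lambda>n. AB r A\<^sub>0 B\<^sub>0 z n" and ?R = "\<lambda>n. cpoly (r n) z"
  have R: "cmod (?R n) \<le> sqrt (w n) * norm (?E n)" for n
    using variation_of_constants[OF r r0 c, of n] cmod_combination_le[of n "fst (?E n)" "snd (?E n)"]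
    by simp
  have "norm (?E n) \<le> (\<Prod>k<n. 1 + cmod z * w k)"
  proof (induction n)
    case 0
    then show ?case using init by (simp add: AB_def)
  next
    case (Suc n)
    have "?E (Suc n) = ?E n + (- z * v n * ?R n, z * u n * ?R n)"
      by (simp add: AB_def algebra_simps)
    then have "norm (?E (Suc n)) \<le> norm (?E n) + norm (- z * v n * ?R n, z * u n * ?R n)"
      by (metis norm_triangle_ineq)
    also have "norm (- z * v n * ?R n, z * u n * ?R n) = sqrt ((cmod z * cmod (?R n))\<^sup>2 * w n)"
      by (simp add: norm_Pair w_def norm_mult power_mult_distrib algebra_simps)
    also have "\<dots> = cmod z * cmod (?R n) * sqrt (w n)"
      by (simp add: real_sqrt_mult)
    also have "\<dots> \<le> cmod z * (sqrt (w n) * norm (?E n)) * sqrt (w n)"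
      by (intro mult_right_mono mult_left_mono R) (auto simp: w_nonneg)
    also have "\<dots> = cmod z * w n * norm (?E n)"
      using w_nonneg[of n] by simp
    also have "norm (?E n) + \<dots> = norm (?E n) * (1 + cmod z * w n)"
      by (simp add: algebra_simps)
    also have "\<dots> \<le> (\<Prod>k<n. 1 + cmod z * w k) * (1 + cmod z * w n)"
      using w_nonneg by (intro mult_right_mono Suc) auto
    finally show ?case by simp
  qed
  then have "sqrt (w n) * norm (?E n) \<le> sqrt (w n) * (\<Prod>k<n. 1 + cmod z * w k)"
    by (intro mult_left_mono) (auto simp: w_nonneg)
  with R show ?thesis by (rule order_trans)
qed

lemma P_bound: "cmod (cpoly (P n) z) \<le> sqrt (w n) * (\<Prod>k<n. 1 + cmod z * w k)"
proof (rule solution_bound[OF P_rec, of z 1 0])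
  show "norm (1 :: complex, 0 :: complex) \<le> 1"
    unfolding norm_Pair by simp
qed (simp_all add: P_0)

lemma Q_bound: "cmod (cpoly (Q n) z) \<le> sqrt (w n) * (\<Prod>k<n. 1 + cmod z * w k)"
proof (rule solution_bound[OF Q_rec, of z 0 1])
  show "norm (0 :: complex, 1 :: complex) \<le> 1"
    unfolding norm_Pair by simp
qed (simp_all add: Q_0)

end

section \<open>Consequences of summability at the origin\<close>

locale ell_jacobi_recurrence = jacobi_recurrence +
  fixes \<alpha> :: real
  assumes \<alpha>: "0 < \<alpha>" "\<alpha> \<le> 1"
    and u_summable: "summable (\<lambda>n. \<bar>u n\<bar> powr (2 * \<alpha>))"
    and v_summable: "summable (\<lambda>n. \<bar>v n\<bar> powr (2 * \<alpha>))"
begin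

definition K :: real where "K = 1 / \<alpha> * (\<Sum>n. \<bar>u n\<bar> powr (2 * \<alpha>) + \<bar>v n\<bar> powr (2 * \<alpha>))"

definition C :: real where "C = sqrt (\<Sum>n. w n)"

lemma uv_summable: "summable (\<lambda>n. \<bar>u n\<bar> powr (2 * \<alpha>) + \<bar>v n\<bar> powr (2 * \<alpha>))"
  by (intro summable_add u_summable v_summable)

lemma abs_sq_powr: "(x\<^sup>2) powr \<alpha> = \<bar>x\<bar> powr (2 * \<alpha>)" for x :: real
  using cmod_sq_powr[of "of_real x" \<alpha>] by simp

lemma w_powr_le: "w n powr \<alpha> \<le> \<bar>u n\<bar> powr (2 * \<alpha>) + \<bar>v n\<bar> powr (2 * \<alpha>)"
  using powr_add_le_add_powr[of "(u n)\<^sup>2" "(v n)\<^sup>2" \<alpha>] \<alpha> by (simp add: w_def abs_sq_powr)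

lemma w_powr_summable: "summable (\<lambda>n. w n powr \<alpha>)"
  by (rule summable_comparison_test'[OF uv_summable, of 0]) (simp add: w_powr_le)

text \<open>The terms are eventually below 1, where \<open>w n \<le> w n powr \<alpha>\<close>
  because \<open>\<alpha> \<le> 1\<close>.\<close>

lemma w_summable: "summable w"
proof -
  have "\<forall>\<^sub>F n in sequentially. w n powr \<alpha> < 1"
    using summable_LIMSEQ_zero[OF w_powr_summable] by (rule order_tendstoD) simp
  then have "\<forall>\<^sub>F n in sequentially. norm (w n) \<le> w n powr \<alpha>"
  proof eventually_elim
    case (elim n)
    then have "w n \<le> 1"
      using \<alpha> by (metis ge_one_powr_ge_zero less_eq_real_def not_le)
    then show ?case
      using powr_mono'[of \<alpha> 1 "w n"] \<alpha> w_nonneg[of n] by simp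
  qed
  then show ?thesis
    by (rule summable_comparison_test_ev[OF _ w_powr_summable])
qed

lemma K_pos: "0 < K"
proof -
  have "0 < (\<Sum>n. \<bar>u n\<bar> powr (2 * \<alpha>) + \<bar>v n\<bar> powr (2 * \<alpha>))"
    by (rule suminf_pos2[OF uv_summable, of 0]) auto
  then show ?thesis using \<alpha> by (simp add: K_def)
qed

lemma C_ge_1: "1 \<le> C"
proof -
  have "sum w {..<1} \<le> (\<Sum>n. w n)"
    by (rule sum_le_suminf[OF w_summable]) (auto simp: w_nonneg)
  then show ?thesis by (simp add: C_def w_def)
qed

lemma prod_le: "(\<Prod>k<n. 1 + cmod z * w k) \<le> exp (K * cmod z powr \<alpha>)"
proof -
  have "(\<Prod>k<n. 1 + cmod z * w k) \<le> (\<Prod>k<n. exp ((cmod z * w k) powr \<alpha> / \<alpha>))"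
    using \<alpha> w_nonneg by (intro prod_mono conjI one_plus_le_exp_powr) auto
  also have "\<dots> = exp (cmod z powr \<alpha> / \<alpha> * (\<Sum>k<n. w k powr \<alpha>))"
    by (simp add: exp_sum sum_distrib_left powr_mult w_nonneg)
  also have "cmod z powr \<alpha> / \<alpha> * (\<Sum>k<n. w k powr \<alpha>)
      \<le> cmod z powr \<alpha> / \<alpha> * (\<Sum>k. \<bar>u k\<bar> powr (2 * \<alpha>) + \<bar>v k\<bar> powr (2 * \<alpha>))"
  proof (rule mult_left_mono)
    have "(\<Sum>k<n. w k powr \<alpha>) \<le> (\<Sum>k<n. \<bar>u k\<bar> powr (2 * \<alpha>) + \<bar>v k\<bar> powr (2 * \<alpha>))"
      by (intro sum_mono w_powr_le)
    also have "\<dots> \<le> (\<Sum>k. \<bar>u k\<bar> powr (2 * \<alpha>) + \<bar>v k\<bar> powr (2 * \<alpha>))"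
      by (intro sum_le_suminf uv_summable) auto
    finally show "(\<Sum>k<n. w k powr \<alpha>) \<le> (\<Sum>k. \<bar>u k\<bar> powr (2 * \<alpha>) + \<bar>v k\<bar> powr (2 * \<alpha>))" .
  qed (use \<alpha> in simp)
  also have "\<dots> = K * cmod z powr \<alpha>"
    by (simp add: K_def)
  finally show ?thesis by simp
qed

text \<open>The estimate shared by \<open>P\<close> and \<open>Q\<close>; its consequences are then
  derived once for both.\<close>

definition bounded_solution :: "(nat \<Rightarrow> real poly) \<Rightarrow> bool" where
  "bounded_solution r \<longleftrightarrow>
    (\<forall>n z. cmod (cpoly (r n) z) \<le> sqrt (w n) * exp (K * cmod z powr \<alpha>))"

lemma bounded_solution_P: "bounded_solution P" and bounded_solution_Q: "bounded_solution Q"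
  unfolding bounded_solution_def
  by (intro allI order_trans[OF P_bound] order_trans[OF Q_bound] mult_left_mono[OF prod_le];
      simp add: w_nonneg)+

context
  fixes r
  assumes r: "bounded_solution r"
begin

lemma sq_bound: "(cmod (cpoly (r n) z))\<^sup>2 \<le> w n * (exp (K * cmod z powr \<alpha>))\<^sup>2"
proof -
  have "(cmod (cpoly (r n) z))\<^sup>2 \<le> (sqrt (w n) * exp (K * cmod z powr \<alpha>))\<^sup>2"
    using r unfolding bounded_solution_def by (intro power_mono) auto
  then show ?thesis using w_nonneg[of n] by (simp add: power_mult_distrib)
qed

lemma sq_summable: "summable (\<lambda>n. (cmod (cpoly (r n) z))\<^sup>2)"
  by (rule summable_comparison_test'[OF summable_mult2[OF w_summable], of 0 _
        "(exp (K * cmod z powr \<alpha>))\<^sup>2"]) (simp add: sq_bound)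

lemma suminf_sq_le: "(\<Sum>n. (cmod (cpoly (r n) z))\<^sup>2) \<le> (C * exp (K * cmod z powr \<alpha>))\<^sup>2"
proof -
  have "(\<Sum>n. (cmod (cpoly (r n) z))\<^sup>2) \<le> (\<Sum>n. w n * (exp (K * cmod z powr \<alpha>))\<^sup>2)"
    by (intro suminf_le sq_bound sq_summable summable_mult2 w_summable)
  also have "\<dots> = (C * exp (K * cmod z powr \<alpha>))\<^sup>2"
    using w_nonneg by (simp add: suminf_mult2[OF w_summable, symmetric] C_def power_mult_distrib
        suminf_nonneg[OF w_summable])
  finally show ?thesis .
qed

lemma l2_function_le: "l2_function r z \<le> C * exp (K * cmod z powr \<alpha>)"
  unfolding l2_function_def using C_ge_1 by (intro real_le_lsqrt suminf_sq_le) auto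

lemma powr_bound:
  assumes "cmod z \<le> R"
  shows "cmod (cpoly (r n) z) powr (2 * \<alpha>) \<le> w n powr \<alpha> * (exp (K * R powr \<alpha>))\<^sup>2 powr \<alpha>"
proof -
  have "(cmod (cpoly (r n) z))\<^sup>2 \<le> w n * (exp (K * cmod z powr \<alpha>))\<^sup>2"
    by (rule sq_bound)
  also have "\<dots> \<le> w n * (exp (K * R powr \<alpha>))\<^sup>2"
    using assms \<alpha> K_pos w_nonneg[of n] by (intro mult_left_mono power_mono) (auto intro!: powr_mono2)
  finally have "(cmod (cpoly (r n) z))\<^sup>2 powr \<alpha> \<le> (w n * (exp (K * R powr \<alpha>))\<^sup>2) powr \<alpha>"
    using \<alpha> by (intro powr_mono2) auto
  then show ?thesis
    by (simp add: cmod_sq_powr powr_mult w_nonneg)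
qed

lemma powr_summable: "summable (\<lambda>n. cmod (cpoly (r n) z) powr (2 * \<alpha>))"
  by (rule summable_comparison_test'[OF summable_mult2[OF w_powr_summable], of 0 _
        "(exp (K * cmod z powr \<alpha>))\<^sup>2 powr \<alpha>"]) (simp add: powr_bound[OF order_refl])

text \<open>On a disc containing \<open>X\<close> the terms are dominated by a constant multiple of
  \<open>w n powr \<alpha>\<close>, so the Weierstrass test applies.\<close>

lemma uniformly_convergent_powr:
  assumes "compact X"
  shows "uniformly_convergent_on X (\<lambda>N z. \<Sum>n<N. cmod (cpoly (r n) z) powr (2 * \<alpha>))"
proof -
  obtain R where R: "\<And>z. z \<in> X \<Longrightarrow> cmod z \<le> R"
    using compact_imp_bounded[OF assms] unfolding bounded_iff by blast
  show ?thesis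
    by (rule Weierstrass_m_test'[OF _ summable_mult2[OF w_powr_summable,
            of "(exp (K * R powr \<alpha>))\<^sup>2 powr \<alpha>"]]) (simp add: powr_bound[OF R])
qed

section \<open>Order and type\<close>

lemma eventually_ln_max_modulus_le:
  "\<forall>\<^sub>F R in at_top. ln (max_modulus (l2_function r) R) \<le> ln C + K * R powr \<alpha>"
  using eventually_ge_at_top[of 0]
proof eventually_elim
  case (elim R)
  have nonneg: "0 \<le> l2_function r z" for z
    unfolding l2_function_def by (auto intro!: suminf_nonneg sq_summable)
  have bd: "norm (l2_function r z) \<le> C * exp (K * R powr \<alpha>)" if "z \<in> cball 0 R" for z
  proof -
    have "l2_function r z \<le> C * exp (K * cmod z powr \<alpha>)" by (rule l2_function_le)
    also have "\<dots> \<le> C * exp (K * R powr \<alpha>)"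
      using that K_pos C_ge_1 \<alpha> by (intro mult_left_mono) (auto intro!: powr_mono2)
    finally show ?thesis using nonneg by simp
  qed
  have le: "max_modulus (l2_function r) R \<le> C * exp (K * R powr \<alpha>)"
    unfolding max_modulus_def using elim by (intro cSUP_least bd) auto
  have ge: "0 \<le> max_modulus (l2_function r) R"
    unfolding max_modulus_def using elim nonneg
    by (intro cSUP_upper2[of _ _ 0] bdd_aboveI2[where M = "C * exp (K * R powr \<alpha>)"] bd) auto
  have "ln (max_modulus (l2_function r) R) \<le> ln (C * exp (K * R powr \<alpha>))"
  \<comment> \<open>At 0 the logarithm takes its default value 0, so this case needs the right-hand
    logarithm to be nonnegative, which \<open>C_ge_1\<close> and \<open>K_pos\<close>
    provide.\<close>
  proof (cases "max_modulus (l2_function r) R = 0")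
    case True
    have "1 \<le> C * exp (K * R powr \<alpha>)"
      using C_ge_1 K_pos by (intro mult_ge1_I) auto
    with True show ?thesis by (simp del: ln_mult)
  next
    case False
    then show ?thesis using le ge by (intro ln_mono) auto
  qed
  then show ?case using C_ge_1 by (simp add: ln_mult)
qed

text \<open>For each \<open>e > 0\<close> the constants \<open>ln C\<close> and \<open>K\<close> are
  absorbed into the factor \<open>R powr e\<close> for large \<open>R\<close>.\<close>

lemma growth_order_le: "growth_order (l2_function r) \<le> ereal \<alpha>"
proof (rule ereal_le_epsilon2)
  fix e :: real assume e: "0 < e"
  have "\<forall>\<^sub>F R in at_top. ln C + K * R powr \<alpha> \<le> R powr (\<alpha> + e)"
    using eventually_powr_ge[OF \<alpha>(1), of "ln C"] eventually_powr_ge[OF e, of "K + 1"]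
  proof eventually_elim
    case (elim R)
    have "ln C + K * R powr \<alpha> \<le> R powr \<alpha> * (K + 1)"
      using elim(1) by (simp add: algebra_simps)
    also have "\<dots> \<le> R powr \<alpha> * R powr e"
      by (intro mult_left_mono elim) auto
    finally show ?case by (simp add: powr_add)
  qed
  with eventually_ln_max_modulus_le
  have "\<forall>\<^sub>F R in at_top. ln (max_modulus (l2_function r) R) \<le> R powr (\<alpha> + e)"
    by eventually_elim linarith
  then show "growth_order (l2_function r) \<le> ereal \<alpha> + ereal e"
    unfolding growth_order_def using e \<alpha> by (auto intro!: Inf_lower)
qed

text \<open>The hypothesis fixes the exponent in the type as \<open>\<alpha>\<close>; then
  \<open>ln C\<close> is absorbed into \<open>e * R powr \<alpha>\<close> once
  \<open>R powr \<alpha>\<close> reaches \<open>ln C / e\<close>.\<close>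

lemma growth_type_le:
  assumes "growth_order (l2_function r) = ereal \<alpha>"
  shows "growth_type (l2_function r) \<le> ereal K"
proof (rule ereal_le_epsilon2)
  fix e :: real assume e: "0 < e"
  have "\<forall>\<^sub>F R in at_top. ln C + K * R powr \<alpha> \<le> (K + e) * R powr \<alpha>"
    using eventually_powr_ge[OF \<alpha>(1), of "ln C / e"]
    by eventually_elim (use e in \<open>simp add: field_simps\<close>)
  with eventually_ln_max_modulus_le
  have "\<forall>\<^sub>F R in at_top. ln (max_modulus (l2_function r) R) \<le> (K + e) * R powr \<alpha>"
    by eventually_elim linarith
  then show "growth_type (l2_function r) \<le> ereal K + ereal e"
    unfolding growth_type_def assms using e K_pos by (auto intro!: Inf_lower)
qed

end

text \<open>The Wronskian writes \<open>1 / b n\<close> through products of neighbouring values. By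
  \<open>\<bar>x * y\<bar> \<le> x\<^sup>2 + y\<^sup>2\<close> and subadditivity its power is
  dominated by a term of a convergent series plus the next term.\<close>

lemma inverse_b_summable: "summable (\<lambda>n. (1 / b n) powr \<alpha>)"
proof -
  let ?f = "\<lambda>n. \<bar>u n\<bar> powr (2 * \<alpha>) + \<bar>v n\<bar> powr (2 * \<alpha>)"
  have ab: "\<bar>x * y\<bar> powr \<alpha> \<le> \<bar>x\<bar> powr (2 * \<alpha>) + \<bar>y\<bar> powr (2 * \<alpha>)" for x y :: real
  proof -
    have "\<bar>x * y\<bar> \<le> x\<^sup>2 + y\<^sup>2"
      using sum_squares_bound[of "\<bar>x\<bar>" "\<bar>y\<bar>"] abs_ge_zero[of "x * y"]
      unfolding abs_mult power2_abs by linarith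
    then have "\<bar>x * y\<bar> powr \<alpha> \<le> (x\<^sup>2 + y\<^sup>2) powr \<alpha>"
      using \<alpha> by (intro powr_mono2) auto
    also have "\<dots> \<le> \<bar>x\<bar> powr (2 * \<alpha>) + \<bar>y\<bar> powr (2 * \<alpha>)"
      using powr_add_le_add_powr[of "x\<^sup>2" "y\<^sup>2" \<alpha>] \<alpha> by (simp add: abs_sq_powr)
    finally show ?thesis .
  qed
  have "norm ((1 / b n) powr \<alpha>) \<le> ?f n + ?f (Suc n)" for n
  proof -
    have "1 / b n = u n * v (Suc n) - u (Suc n) * v n"
      using wronskian[of n] b_pos[of n] by (simp add: field_simps)
    also have "\<dots> \<le> \<bar>u n * v (Suc n)\<bar> + \<bar>u (Suc n) * v n\<bar>" by linarith
    finally have "(1 / b n) powr \<alpha> \<le> (\<bar>u n * v (Suc n)\<bar> + \<bar>u (Suc n) * v n\<bar>) powr \<alpha>"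
      using \<alpha> b_pos[of n] by (intro powr_mono2) auto
    also have "\<dots> \<le> \<bar>u n * v (Suc n)\<bar> powr \<alpha> + \<bar>u (Suc n) * v n\<bar> powr \<alpha>"
      using \<alpha> by (intro powr_add_le_add_powr) auto
    finally show ?thesis using ab[of "u n" "v (Suc n)"] ab[of "u (Suc n)" "v n"] by simp
  qed
  then show ?thesis
    by (rule summable_comparison_test'[OF summable_add[OF uv_summable
            iffD2[OF summable_Suc_iff uv_summable]], of 0])
qed

end

section \<open>Assembly of the equivalence and its consequences\<close>

lemma sq_in_ell_iff:
  "(\<lambda>n. (cpoly (r n) z)\<^sup>2) \<in> ell \<alpha> \<longleftrightarrow> summable (\<lambda>n. cmod (cpoly (r n) z) powr (2 * \<alpha>))"
  by (simp add: ell_def norm_power cmod_sq_powr)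

theorem theorem1p2:
  fixes \<mu> :: "real measure" and s :: "nat \<Rightarrow> real"
    and P Q :: "nat \<Rightarrow> real poly"
    and a b :: "nat \<Rightarrow> real" and \<alpha> :: real
  assumes "normalized_hamburger \<mu> s"
    and "orthonormal_polys \<mu> P"
    and "recurrence_coeffs a b P"
    and "second_kind_polys a b Q"
    and "0 < \<alpha>" and "\<alpha> \<le> 1"
  shows
    "(((\<lambda>n. (cpoly (P n) 0)\<^sup>2) \<in> ell \<alpha> \<and> (\<lambda>n. (cpoly (Q n) 0)\<^sup>2) \<in> ell \<alpha>) \<longleftrightarrow>
      (\<forall>z. (\<lambda>n. (cpoly (P n) z)\<^sup>2) \<in> ell \<alpha> \<and> (\<lambda>n. (cpoly (Q n) z)\<^sup>2) \<in> ell \<alpha>)) \<and>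
     ((\<lambda>n. (cpoly (P n) 0)\<^sup>2) \<in> ell \<alpha> \<and> (\<lambda>n. (cpoly (Q n) 0)\<^sup>2) \<in> ell \<alpha> \<longrightarrow>
      indeterminate s \<and>
      (\<forall>X. compact X \<longrightarrow>
         uniformly_convergent_on X (\<lambda>N z. \<Sum>n<N. cmod (cpoly (P n) z) powr (2 * \<alpha>)) \<and>
         uniformly_convergent_on X (\<lambda>N z. \<Sum>n<N. cmod (cpoly (Q n) z) powr (2 * \<alpha>))) \<and>
      (\<lambda>n. complex_of_real (1 / b n)) \<in> ell \<alpha> \<and>
      (\<forall>z. summable (\<lambda>n. (cmod (cpoly (P n) z))\<^sup>2) \<and> summable (\<lambda>n. (cmod (cpoly (Q n) z))\<^sup>2)) \<and>
      (let C = sqrt (\<Sum>n. (poly (P n) 0)\<^sup>2 + (poly (Q n) 0)\<^sup>2);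
           K = 1 / \<alpha> * (\<Sum>n. \<bar>poly (P n) 0\<bar> powr (2 * \<alpha>) + \<bar>poly (Q n) 0\<bar> powr (2 * \<alpha>))
       in (\<forall>z. l2_function P z \<le> C * exp (K * cmod z powr \<alpha>)) \<and>
          growth_order (l2_function P) \<le> ereal \<alpha> \<and>
          (growth_order (l2_function P) = ereal \<alpha> \<longrightarrow>
             growth_type (l2_function P) \<le> ereal K)))"
proof -
  let ?ell0 = "(\<lambda>n. (cpoly (P n) 0)\<^sup>2) \<in> ell \<alpha> \<and> (\<lambda>n. (cpoly (Q n) 0)\<^sup>2) \<in> ell \<alpha>"
  interpret jacobi_recurrence a b P Q
    by standard fact+
  interpret moment_functional \<mu> s P
    using assms(1,2) by unfold_locales (auto simp: normalized_hamburger_def)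
  have ell_locale: "ell_jacobi_recurrence a b P Q \<alpha>" if ?ell0
    using that[unfolded sq_in_ell_iff] assms(5,6)
    by unfold_locales (simp_all add: cpoly_at_0 u_def v_def)
  show ?thesis
  proof (intro conjI impI iffI)
    assume ?ell0
    then interpret ell_jacobi_recurrence a b P Q \<alpha> by (rule ell_locale)
    show "\<forall>z. (\<lambda>n. (cpoly (P n) z)\<^sup>2) \<in> ell \<alpha> \<and> (\<lambda>n. (cpoly (Q n) z)\<^sup>2) \<in> ell \<alpha>"
      unfolding sq_in_ell_iff
      by (intro allI conjI powr_summable bounded_solution_P bounded_solution_Q)
  next
    assume ?ell0
    then interpret ell_jacobi_recurrence a b P Q \<alpha> by (rule ell_locale)
    have sq: "(cmod (cpoly (P n) (of_real x)))\<^sup>2 = (poly (P n) x)\<^sup>2" for n x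
      by simp
    \<comment> \<open>On the unit interval \<open>\<bar>x\<bar> powr \<alpha> \<le> 1\<close>, so
      the sums of squares have the common bound \<open>(C * exp K)\<^sup>2\<close>.\<close>
    show "indeterminate s"
    proof (rule indeterminate_if_bounded_on_infinite_set[of "{0..1}"])
      show "prob_space \<mu>" using assms(1) by (simp add: normalized_hamburger_def)
      fix x :: real assume x: "x \<in> {0..1}"
      show "summable (\<lambda>n. (poly (P n) x)\<^sup>2)"
        using sq_summable[OF bounded_solution_P, of "of_real x"] unfolding sq .
      have "(\<Sum>n. (poly (P n) x)\<^sup>2) \<le> (C * exp (K * \<bar>x\<bar> powr \<alpha>))\<^sup>2"
        using suminf_sq_le[OF bounded_solution_P, of "of_real x"] unfolding sq by simp
      also have "\<bar>x\<bar> powr \<alpha> \<le> 1"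
        using x assms(5) by (auto intro: powr_le1)
      then have "(C * exp (K * \<bar>x\<bar> powr \<alpha>))\<^sup>2 \<le> (C * exp K)\<^sup>2"
        using K_pos C_ge_1 by (intro power_mono mult_left_mono) (auto simp: mult_le_cancel_left1)
      finally show "(\<Sum>n. (poly (P n) x)\<^sup>2) \<le> (C * exp K)\<^sup>2" .
    qed simp
    show "\<forall>X. compact X \<longrightarrow>
         uniformly_convergent_on X (\<lambda>N z. \<Sum>n<N. cmod (cpoly (P n) z) powr (2 * \<alpha>)) \<and>
         uniformly_convergent_on X (\<lambda>N z. \<Sum>n<N. cmod (cpoly (Q n) z) powr (2 * \<alpha>))"
      by (intro allI impI conjI uniformly_convergent_powr bounded_solution_P bounded_solution_Q)
    show "(\<lambda>n. complex_of_real (1 / b n)) \<in> ell \<alpha>"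
      using inverse_b_summable b_pos by (simp add: ell_def norm_divide less_imp_le)
    show "\<forall>z. summable (\<lambda>n. (cmod (cpoly (P n) z))\<^sup>2) \<and> summable (\<lambda>n. (cmod (cpoly (Q n) z))\<^sup>2)"
      by (intro allI conjI sq_summable bounded_solution_P bounded_solution_Q)
    show "let C = sqrt (\<Sum>n. (poly (P n) 0)\<^sup>2 + (poly (Q n) 0)\<^sup>2);
           K = 1 / \<alpha> * (\<Sum>n. \<bar>poly (P n) 0\<bar> powr (2 * \<alpha>) + \<bar>poly (Q n) 0\<bar> powr (2 * \<alpha>))
       in (\<forall>z. l2_function P z \<le> C * exp (K * cmod z powr \<alpha>)) \<and>
          growth_order (l2_function P) \<le> ereal \<alpha> \<and>
          (growth_order (l2_function P) = ereal \<alpha> \<longrightarrow> growth_type (l2_function P) \<le> ereal K)"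
      unfolding Let_def
      using l2_function_le[OF bounded_solution_P] growth_order_le[OF bounded_solution_P]
        growth_type_le[OF bounded_solution_P]
      unfolding C_def K_def w_def u_def v_def by blast
  \<comment> \<open>What remains is the converse implication, by specialising to
    \<open>z = 0\<close>.\<close>
  qed blast+
qed

end
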